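(* Put $\ell_\varnothing=1$ and $\ell_{1^m}=1$ for $m\ge 1$. Every word $v$ in the letters $0,1$ containing a zero has a unique expression $v=a_1\cdots a_r1^m$ with $a_r=0$ ($r\ge 1$, $m\ge 0$); for such a word put $$\ell_v=\frac{(-1)^r}{m!}\int_{0<t_1<\cdots<t_r<1}t_1\,\omega_{a_1}(t_1)\cdots\omega_{a_r}(t_r)\bigl(-\log(1-t_r)\bigr)^m .$$ Define $k_\varnothing=1$ and, for a letter $a$ and a word $u$, $k_{au}=\ell_{au}+\varepsilon_a\ell_u$, where $\varepsilon_0=1$, $\varepsilon_1=-1$. Then set $$g_v=\sum_{v=u1^m}k_u\,\frac{(-2\pi i)^m}{(m+1)!},$$ the sum running over all ways to remove a final string of ones from $v$, including the empty string ($m=0$); in particular $g_\varnothing=1$. Then for every word $w=i_1\cdots i_n$ the matrix of the Hodge defect $\mathcal G_I(\mathcal E_w)$, in the basis $q_0,\dots,q_n$, has entries $$(\mathcal G_I(\mathcal E_w))_{ba}=\begin{cases} 0, & b<a, \\ 1, & b=a, \\ {g_{v_{ba}}}, & b>a, \end{cases}\qquad v_{ba}=i_{n-b+1}\cdots i_{n-a}.$$ All the integrals defining the $\ell_v$ converge.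
   Context: Notation: $\omega_0(t)=dt/t$, $\omega_1(t)=dt/(1-t)$; $1^m$ is the word consisting of $m$ letters $1$; $\varnothing$ is the empty word. Word connections. For a word $w=i_1\cdots i_n$, $i_r\in\{0,1\}$, let $E_w$ be the complex vector space with basis $q_0,\dots,q_n$. Define the nilpotent operators $N_a^{(w)}$, $a\in\{0,1\}$, by $N_a^{(w)}q_r=q_{r+1}$ if $0\le r<n$ and $a=i_{n-r}$, $N_a^{(w)}q_r=0$ if $0\le r<n$ and $a\ne i_{n-r}$, and $N_a^{(w)}q_n=0$. The word connection $\mathcal E_w$ is $\nabla_w=d-N_0^{(w)}\omega_0-N_1^{(w)}\omega_1$ on $E_w\otimes\mathcal O$ over $\mathbb P^1\setminus\{0,1,\infty\}$. Matrices act on columns: the $(b,a)$-entry is the coefficient of $q_b$ in the image of $q_a$. Hodge defect of a word connection. By definition $\mathcal G_I(\mathcal E_w)$ is the value at $N_0=N_0^{(w)}$, $N_1=N_1^{(w)}$ of $$(1+N_0-N_1)\Bigl(\int_0^1G_1(t)\,dt\Bigr)U_1,\qquad U_1=\sum_{m\ge 0}\frac{(-2\pi iN_1)^m}{(m+1)!},$$ where $G_1$ is the matrix solution on $0<z<1$ of $dG_1=(N_0\omega_0+N_1\omega_1)G_1$ with $G_1(z)(1-z)^{N_1}\to 1$ as $z\to 1$ (real logarithms). For a unipotent variation of mixed Hodge–Tate structures on $\mathbb P^1\setminus\{0,1,\infty\}$ with connection $d-N_0\omega_0-N_1\omega_1$, this formula gives the matrix of the Hodge defect of the shrinking isomorphism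 along $I=[0,1]$ from vanishing cycles at $1$ to the cohomology of the extension by $*$ at $0,1$ and $!$ at $\infty$. *)

theory Defs
  imports "HOL-Analysis.Analysis" "Jordan_Normal_Form.Matrix"
begin

datatype letter = L0 | L1

fun omega :: "letter \<Rightarrow> real \<Rightarrow> real" where
  "omega L0 t = 1 / t"
| "omega L1 t = 1 / (1 - t)"

text \<open>Words are lists with \<open>i\<^sub>1\<close> at the head, so the one-based letter \<open>i\<^sub>j\<close> is \<open>w ! (j - 1)\<close>.
  Entry \<open>(b, r)\<close> of \<open>word_op a w\<close> is the coefficient of \<open>q\<^sub>b\<close> in the image of \<open>q\<^sub>r\<close>.\<close>

definition word_op :: "letter \<Rightarrow> letter list \<Rightarrow> complex mat" where
  "word_op a w = Matrix.mat (length w + 1) (length w + 1)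
     (\<lambda>(b, r). if r < length w \<and> b = r + 1 \<and> a = w ! (length w - r - 1) then 1 else 0)"

text \<open>The power series \<open>\<Sum>m. c m A\<^sup>m\<close> of a \<open>d \<times> d\<close> matrix, formed entrywise; for nilpotent
  \<open>A\<close> each entry is a finite sum.\<close>

definition mat_series :: "nat \<Rightarrow> (nat \<Rightarrow> complex) \<Rightarrow> complex mat \<Rightarrow> complex mat" where
  "mat_series d c A = Matrix.mat d d (\<lambda>(i, j). \<Sum>m. c m * (A ^\<^sub>m m) $$ (i, j))"

definition mat_power :: "nat \<Rightarrow> real \<Rightarrow> complex mat \<Rightarrow> complex mat" where
  "mat_power d x A = mat_series d (\<lambda>m. complex_of_real (ln x) ^ m / fact m) A"

definition U1 :: "nat \<Rightarrow> complex mat \<Rightarrow> complex mat" where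
  "U1 d N1 = mat_series d (\<lambda>m. (- 2 * complex_of_real pi * \<i>) ^ m / fact (m + 1)) N1"

text \<open>The solution is a function on the open interval \<open>(0,1)\<close>; the last condition only fixes
  junk values outside it, so that a unique total function can be selected.\<close>

definition normalized_solution ::
  "nat \<Rightarrow> complex mat \<Rightarrow> complex mat \<Rightarrow> (real \<Rightarrow> complex mat) \<Rightarrow> bool" where
  "normalized_solution d N0 N1 G \<longleftrightarrow>
     (\<forall>z. 0 < z \<and> z < 1 \<longrightarrow> G z \<in> carrier_mat d d \<and>
        (\<forall>i<d. \<forall>j<d. ((\<lambda>x. G x $$ (i, j)) has_vector_derivative
           (((complex_of_real (omega L0 z) \<cdot>\<^sub>m N0 + complex_of_real (omega L1 z) \<cdot>\<^sub>m N1) * G z)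
              $$ (i, j))) (at z))) \<and>
     (\<forall>i<d. \<forall>j<d. ((\<lambda>z. (G z * mat_power d (1 - z) N1) $$ (i, j))
        \<longlongrightarrow> (1\<^sub>m d :: complex mat) $$ (i, j)) (at_left 1)) \<and>
     (\<forall>z. \<not> (0 < z \<and> z < 1) \<longrightarrow> G z = 0\<^sub>m d d)"

definition G1 :: "nat \<Rightarrow> complex mat \<Rightarrow> complex mat \<Rightarrow> real \<Rightarrow> complex mat" where
  "G1 d N0 N1 = (THE G. normalized_solution d N0 N1 G)"

definition hodge_defect :: "nat \<Rightarrow> complex mat \<Rightarrow> complex mat \<Rightarrow> complex mat" where
  "hodge_defect d N0 N1 =
     (1\<^sub>m d + N0 - N1)
     * Matrix.mat d d (\<lambda>(i, j). LBINT t:{0<..<1}. G1 d N0 N1 t $$ (i, j))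
     * U1 d N1"

definition word_hodge_defect :: "letter list \<Rightarrow> complex mat" where
  "word_hodge_defect w = hodge_defect (length w + 1) (word_op L0 w) (word_op L1 w)"

text \<open>The variables \<open>t\<^sub>1, \<dots>, t\<^sub>r\<close> are the coordinates \<open>t 0, \<dots>, t (r - 1)\<close> of a point of
  the product space indexed by \<open>{..<r}\<close>.\<close>

definition open_simplex :: "nat \<Rightarrow> (nat \<Rightarrow> real) set" where
  "open_simplex r =
     {t. (\<forall>i<r. 0 < t i \<and> t i < 1) \<and> (\<forall>i j. i < j \<and> j < r \<longrightarrow> t i < t j)}"

definition ell_integrand :: "letter list \<Rightarrow> nat \<Rightarrow> (nat \<Rightarrow> real) \<Rightarrow> real" where
  "ell_integrand a m t =
     t 0 * (\<Prod>i<length a. omega (a ! i) (t i)) * (- ln (1 - t (length a - 1))) ^ m"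

abbreviation simplex_measure :: "nat \<Rightarrow> (nat \<Rightarrow> real) measure" where
  "simplex_measure r \<equiv> Pi\<^sub>M {..<r} (\<lambda>_. lborel)"

definition is_splitting :: "letter list \<Rightarrow> letter list \<times> nat \<Rightarrow> bool" where
  "is_splitting v = (\<lambda>(a, m). a \<noteq> [] \<and> last a = L0 \<and> v = a @ replicate m L1)"

definition ell :: "letter list \<Rightarrow> real" where
  "ell v = (if L0 \<in> set v then
      (case (THE p. is_splitting v p) of (a, m) \<Rightarrow>
         (- 1) ^ length a / fact m *
         (LINT t:open_simplex (length a)|simplex_measure (length a). ell_integrand a m t))
    else 1)"

fun eps :: "letter \<Rightarrow> real" where
  "eps L0 = 1"
| "eps L1 = - 1"

fun kcoef :: "letter list \<Rightarrow> real" where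
  "kcoef [] = 1"
| "kcoef (a # u) = ell (a # u) + eps a * ell u"

definition gcoef :: "letter list \<Rightarrow> complex" where
  "gcoef v = (\<Sum>(u, m) \<in> {(u, m). v = u @ replicate m L1}.
     complex_of_real (kcoef u) * (- 2 * complex_of_real pi * \<i>) ^ m / fact (m + 1))"

lemma finite_one_suffixes: "finite {(u, m). v = u @ replicate m L1}"
proof (rule finite_subset)
  show "{(u, m). v = u @ replicate m L1} \<subseteq> (\<lambda>m. (take (length v - m) v, m)) ` {..length v}"
    by (auto simp: image_iff)
qed simp

text \<open>The subword \<open>i\<^bsub>n-b+1\<^esub> \<cdots> i\<^bsub>n-a\<^esub>\<close> of a word of length \<open>n\<close>.\<close>

definition subword :: "letter list \<Rightarrow> nat \<Rightarrow> nat \<Rightarrow> letter list" where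
  "subword w b a = drop (length w - b) (take (length w - a) w)"

end

theory Submission
  imports Defs
begin

text \<open>An entry \<open>(b, a)\<close> of a product of matrices whose entries depend only on the word
  \<open>v\<^bsub>ba\<^esub>\<close> depends only on that word, through the sum over its cuts into a prefix and a suffix.
  All matrices in the formula for the Hodge defect are of this kind, so the computation takes place
  in the algebra of formal series in the noncommuting letters. There the solution has coefficients
  \<open>(- log (1 - z))\<^sup>m / m!\<close> at \<open>1\<^sup>m\<close>, and up to sign the iterated integral from \<open>z\<close> to \<open>1\<close> at
  words containing a zero; its integral over \<open>(0,1)\<close> is \<open>ell\<close> because integrating out
  \<open>z < t\<^sub>1\<close> produces the factor \<open>t\<^sub>1\<close>. Multiplication by \<open>1 + N\<^sub>0 - N\<^sub>1\<close> turns \<open>ell\<close> into \<open>kcoef\<close>,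
  and multiplication by \<open>U1\<close> turns \<open>kcoef\<close> into \<open>gcoef\<close>.\<close>

subsection \<open>Matrices indexed by subwords\<close>

text \<open>The point 1 is singular for the equation, so it offers no initial value. Comparing
  coefficients, the one at \<open>c # u\<close> has derivative \<open>omega c\<close> times the one
  at \<open>u\<close>. Integrating from 1 converges for words containing a zero and diverges for
  nonempty words of ones. For the latter the normalization decides: their generating series has to
  be the inverse of (1 - z)^N1, which is where the powers of the logarithm come from. The remaining
  coefficients must decay at 1 fast enough to beat every power of the logarithm and must be
  integrable at 0; a single square root bound gives both. Signs are split off from the integrals, so
  that the analysis concerns nonnegative functions and Tonelli's theorem applies. The order of
  multiplication fits because the operators read the word from its end: v_ba is v_bc followed by
  v_ca whenever a \<le> c \<le> b.\<close>

definition word_mat :: "letter list \<Rightarrow> (letter list \<Rightarrow> complex) \<Rightarrow> complex mat" where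
  "word_mat w f = Matrix.mat (length w + 1) (length w + 1)
     (\<lambda>(b, a). if b < a then 0 else f (subword w b a))"

text \<open>The product of noncommutative formal series, dual to deconcatenation of words.\<close>

definition conv :: "(letter list \<Rightarrow> complex) \<Rightarrow> (letter list \<Rightarrow> complex) \<Rightarrow> letter list \<Rightarrow> complex" where
  "conv f g v = (\<Sum>k\<le>length v. f (take k v) * g (drop k v))"

lemma length_subword: "b \<le> length w \<Longrightarrow> length (subword w b a) = b - a"
  by (auto simp: subword_def)

text \<open>For b < a truncated subtraction still yields the empty word. This is why
  \<open>word_mat\<close> needs its explicit zero above the diagonal: otherwise \<open>f []\<close>
  would stand there.\<close>

lemma subword_self: "b \<le> a \<Longrightarrow> subword w b a = []"
  by (auto simp: subword_def)

lemma subword_Suc: "a < length w \<Longrightarrow> subword w (Suc a) a = [w ! (length w - a - 1)]"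
  by (intro nth_equalityI) (auto simp: subword_def)

lemma take_subword:
  assumes "a \<le> c" "c \<le> b" "b \<le> length w"
  shows "take (b - c) (subword w b a) = subword w b c"
proof -
  have "length w - b + (b - c) = length w - c" using assms by simp
  then show ?thesis using assms by (simp add: subword_def take_drop min_def)
qed

lemma drop_subword:
  assumes "a \<le> c" "c \<le> b" "b \<le> length w"
  shows "drop (b - c) (subword w b a) = subword w c a"
  using assms by (simp add: subword_def)

lemma word_mat_carrier [simp]: "word_mat w f \<in> carrier_mat (length w + 1) (length w + 1)"
  by (simp add: word_mat_def)

lemma dim_word_mat [simp]:
  "dim_row (word_mat w f) = Suc (length w)" "dim_col (word_mat w f) = Suc (length w)"
  by (simp_all add: word_mat_def)

lemma word_mat_entry:
  "b \<le> length w \<Longrightarrow> a \<le> length w \<Longrightarrow>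
     word_mat w f $$ (b, a) = (if b < a then 0 else f (subword w b a))"
  by (simp add: word_mat_def)

lemma word_mat_mult: "word_mat w f * word_mat w g = word_mat w (conv f g)"
proof (rule eq_matI)
  fix b a assume "b < dim_row (word_mat w (conv f g))" "a < dim_col (word_mat w (conv f g))"
  then have ba: "b \<le> length w" "a \<le> length w" by auto
  have "(word_mat w f * word_mat w g) $$ (b, a)
      = (\<Sum>c<Suc (length w). word_mat w f $$ (b, c) * word_mat w g $$ (c, a))"
    using ba by (simp add: scalar_prod_def atLeast0LessThan)
  also have "\<dots> = (\<Sum>c\<in>{a..b}. f (subword w b c) * g (subword w c a))"
    using ba by (intro sum.mono_neutral_cong_right) (auto simp: word_mat_entry)
  also have "\<dots> = word_mat w (conv f g) $$ (b, a)"
  proof (cases "b < a")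
    case False
    \<comment> \<open>The intermediate index c cuts the word after its first b - c letters.\<close>
    have "(\<Sum>c\<in>{a..b}. f (subword w b c) * g (subword w c a))
        = (\<Sum>k\<le>b - a. f (take k (subword w b a)) * g (drop k (subword w b a)))"
      using ba False
      by (intro sum.reindex_bij_witness[of _ "\<lambda>k. b - k" "\<lambda>c. b - c"])
         (auto simp: take_subword drop_subword)
    then show ?thesis using ba False by (simp add: word_mat_entry conv_def length_subword)
  qed (use ba in \<open>simp add: word_mat_entry\<close>)
  finally show "(word_mat w f * word_mat w g) $$ (b, a) = word_mat w (conv f g) $$ (b, a)" .
qed simp_all

lemma word_op_eq: "word_op c w = word_mat w (\<lambda>v. if v = [c] then 1 else 0)"
proof (rule eq_matI)
  fix b a assume "b < dim_row (word_mat w (\<lambda>v. if v = [c] then 1 else 0))"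
    "a < dim_col (word_mat w (\<lambda>v. if v = [c] then 1 else 0))"
  then have ba: "b \<le> length w" "a \<le> length w" by auto
  have *: "b = Suc a" if "subword w b a = [c]"
    using length_subword[OF ba(1), of a] that by simp
  show "word_op c w $$ (b, a) = word_mat w (\<lambda>v. if v = [c] then 1 else 0) $$ (b, a)"
  proof (cases "b = Suc a")
    case True
    then show ?thesis using ba by (auto simp: word_op_def word_mat_entry subword_Suc)
  next
    case False
    then show ?thesis using ba * by (auto simp: word_op_def word_mat_entry)
  qed
qed (auto simp: word_op_def)

lemma one_mat_eq: "1\<^sub>m (length w + 1) = word_mat w (\<lambda>v. if v = [] then 1 else 0)"
proof (rule eq_matI)
  fix b a assume "b < dim_row (word_mat w (\<lambda>v. if v = [] then 1 else 0))"
    "a < dim_col (word_mat w (\<lambda>v. if v = [] then 1 else 0))"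
  then have ba: "b \<le> length w" "a \<le> length w" by auto
  have *: "b \<le> a" if "subword w b a = []"
    using length_subword[OF ba(1), of a] that by simp
  show "1\<^sub>m (length w + 1) $$ (b, a) = word_mat w (\<lambda>v. if v = [] then 1 else 0) $$ (b, a)"
    using ba * by (cases "a = b") (auto simp: word_mat_entry subword_self)
qed auto

lemma word_mat_cong:
  "(\<And>v. f v = g v) \<Longrightarrow> word_mat w f = word_mat w g"
  by (rule arg_cong[of f g]) auto

lemma word_mat_add: "word_mat w f + word_mat w g = word_mat w (\<lambda>v. f v + g v)"
  by (rule eq_matI) (auto simp: word_mat_entry)

lemma word_mat_diff: "word_mat w f - word_mat w g = word_mat w (\<lambda>v. f v - g v)"
  by (rule eq_matI) (auto simp: word_mat_entry)

lemma word_mat_smult: "x \<cdot>\<^sub>m word_mat w f = word_mat w (\<lambda>v. x * f v)"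
  by (rule eq_matI) (auto simp: word_mat_entry)

section \<open>Convolution of word series\<close>

lemma conv_Nil: "conv f g [] = f [] * g []"
  by (simp add: conv_def)

lemma conv_Cons: "conv f g (c # u) = f [] * g (c # u) + conv (\<lambda>v. f (c # v)) g u"
proof -
  have "conv f g (c # u) = (\<Sum>k\<in>{..Suc (length u)}. f (take k (c # u)) * g (drop k (c # u)))"
    by (simp add: conv_def)
  also have "\<dots> = f [] * g (c # u) + (\<Sum>k\<le>length u. f (c # take k u) * g (drop k u))"
    by (subst sum.atMost_Suc_shift) simp
  finally show ?thesis by (simp add: conv_def)
qed

lemma conv_supp_Nil: "(\<And>v. v \<noteq> [] \<Longrightarrow> f v = 0) \<Longrightarrow> conv f g u = f [] * g u"
proof -
  assume f: "\<And>v. v \<noteq> [] \<Longrightarrow> f v = 0"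
  have "f (take k u) = 0" if "k \<in> {..length u} - {0}" for k
    using that by (intro f) auto
  then have "conv f g u = (\<Sum>k\<in>{0}. f (take k u) * g (drop k u))"
    unfolding conv_def by (intro sum.mono_neutral_right) auto
  then show ?thesis by simp
qed

text \<open>Both the connection matrix and 1 + N0 - N1 are supported on words of length at most one,
  so multiplying by them from the left leaves only the first two cuts.\<close>

lemma conv_one_letter:
  assumes "\<And>v. length v > 1 \<Longrightarrow> f v = 0"
  shows "conv f g (c # u) = f [] * g (c # u) + f [c] * g u"
  using assms by (simp add: conv_Cons conv_supp_Nil)

lemma word_op_L1_power:
  "word_op L1 w ^\<^sub>m m = word_mat w (\<lambda>v. if v = replicate m L1 then 1 else 0)"
proof (induction m)
  case 0
  show ?case using one_mat_eq[of w] by (simp add: word_op_def)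
next
  case (Suc m)
  have "conv (\<lambda>v. if v = replicate m L1 then 1 else 0) (\<lambda>v. if v = [L1] then 1 else 0) v
      = (if v = replicate (Suc m) L1 then 1 else 0)" for v
  proof -
    have "conv (\<lambda>v. if v = replicate m L1 then 1 else 0) (\<lambda>v. if v = [L1] then 1 else 0) v
      = (\<Sum>k\<le>length v. if take k v = replicate m L1 \<and> drop k v = [L1] then 1 else 0)"
      unfolding conv_def by (intro sum.cong) auto
    also have "\<dots> = (\<Sum>k\<le>length v. if k = m \<and> v = replicate (Suc m) L1 then 1 else 0)"
    proof (intro sum.cong refl if_cong)
      fix k assume k: "k \<in> {..length v}"
      show "(take k v = replicate m L1 \<and> drop k v = [L1]) = (k = m \<and> v = replicate (Suc m) L1)"
      proof
        assume h: "take k v = replicate m L1 \<and> drop k v = [L1]"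
        then have "length (take k v) = m" by simp
        then have "k = m" using k by simp
        moreover have "v = replicate m L1 @ [L1]" using h append_take_drop_id[of k v] by simp
        ultimately show "k = m \<and> v = replicate (Suc m) L1" by (simp add: replicate_append_same)
      next
        assume "k = m \<and> v = replicate (Suc m) L1"
        then show "take k v = replicate m L1 \<and> drop k v = [L1]"
          by (simp add: replicate_append_same[symmetric])
      qed
    qed
    also have "\<dots> = (if v = replicate (Suc m) L1 then 1 else 0)"
      by (cases "v = replicate (Suc m) L1") simp_all
    finally show ?thesis .
  qed
  then show ?case
    using Suc by (simp add: word_op_eq word_mat_mult cong: word_mat_cong)
qed

lemma replicate_L1_iff: "v = replicate (length v) L1 \<longleftrightarrow> L0 \<notin> set v"
proof
  assume "L0 \<notin> set v"
  then have "\<forall>x\<in>set v. x = L1" by (metis letter.exhaust)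
  then show "v = replicate (length v) L1" by (metis replicate_length_same)
next
  assume "v = replicate (length v) L1"
  then show "L0 \<notin> set v" by (metis in_set_replicate letter.distinct(1))
qed

text \<open>The m-th power is concentrated on the single word of m ones, so each entry meets only
  the exponent equal to the length of its word, and the infinite series collapses to one
  term.\<close>

lemma mat_series_word_op:
  "mat_series (length w + 1) c (word_op L1 w)
     = word_mat w (\<lambda>v. if L0 \<in> set v then 0 else c (length v))"
proof (rule eq_matI)
  fix b a
  assume "b < dim_row (word_mat w (\<lambda>v. if L0 \<in> set v then 0 else c (length v)))"
    "a < dim_col (word_mat w (\<lambda>v. if L0 \<in> set v then 0 else c (length v)))"
  then have ba: "b \<le> length w" "a \<le> length w" by auto
  let ?v = "subword w b a"
  have "(\<lambda>m. c m * (word_op L1 w ^\<^sub>m m) $$ (b, a))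
      = (\<lambda>m. if m = length ?v then (if b < a \<or> L0 \<in> set ?v then 0 else c (length ?v)) else 0)"
  proof
    fix m
    have "?v = replicate m L1 \<longleftrightarrow> m = length ?v \<and> L0 \<notin> set ?v"
      using replicate_L1_iff[of ?v] by (metis length_replicate)
    then show "c m * (word_op L1 w ^\<^sub>m m) $$ (b, a)
      = (if m = length ?v then (if b < a \<or> L0 \<in> set ?v then 0 else c (length ?v)) else 0)"
      using ba by (simp add: word_op_L1_power word_mat_entry replicate_L1_iff)
  qed
  moreover have "(\<Sum>m. if m = length ?v then (if b < a \<or> L0 \<in> set ?v then 0 else c (length ?v)) else 0)
     = (if b < a \<or> L0 \<in> set ?v then 0 else c (length ?v))"
    using sums_single[of "length ?v" "\<lambda>_. (if b < a \<or> L0 \<in> set ?v then 0 else c (length ?v))"]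
    by (simp add: sums_iff)
  ultimately show "mat_series (length w + 1) c (word_op L1 w) $$ (b, a) =
     word_mat w (\<lambda>v. if L0 \<in> set v then 0 else c (length v)) $$ (b, a)"
    using ba by (simp add: mat_series_def word_mat_entry)
qed (auto simp: mat_series_def)

lemma gcoef_eq_conv:
  "gcoef v = conv (\<lambda>u. complex_of_real (kcoef u))
     (\<lambda>u. if L0 \<in> set u then 0
       else (- 2 * complex_of_real pi * \<i>) ^ length u / fact (length u + 1)) v"
proof -
  have "gcoef v = (\<Sum>k | k \<le> length v \<and> L0 \<notin> set (drop k v). complex_of_real (kcoef (take k v)) *
      (- 2 * complex_of_real pi * \<i>) ^ (length v - k) / fact (length v - k + 1))"
    unfolding gcoef_def
  \<comment> \<open>A pair \<open>(u, m)\<close> is determined by the cut position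
    \<open>length u\<close>. The remaining cuts have a zero in the suffix and contribute nothing to
    the convolution.\<close>
  proof (intro sum.reindex_bij_witness[of _ "\<lambda>k. (take k v, length v - k)" "\<lambda>(u, m). length u"])
    fix k assume "k \<in> {k. k \<le> length v \<and> L0 \<notin> set (drop k v)}"
    then show "(take k v, length v - k) \<in> {(u, m). v = u @ replicate m L1}"
      using replicate_L1_iff[of "drop k v"] append_take_drop_id[of k v] by auto
  qed auto
  also have "\<dots> = conv (\<lambda>u. complex_of_real (kcoef u))
     (\<lambda>u. if L0 \<in> set u then 0
       else (- 2 * complex_of_real pi * \<i>) ^ length u / fact (length u + 1)) v"
    unfolding conv_def by (intro sum.mono_neutral_cong_left) auto
  finally show ?thesis .
qed

lemma kcoef_eq_conv:
  "complex_of_real (kcoef v) = conv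
     (\<lambda>v. (if v = [] then 1 else 0) + (if v = [L0] then 1 else 0) - (if v = [L1] then 1 else 0))
     (\<lambda>v. complex_of_real (ell v)) v"
proof (cases v)
  case Nil
  then show ?thesis by (simp add: conv_Nil ell_def)
next
  case (Cons c u)
  show ?thesis
    unfolding Cons by (subst conv_one_letter) (force, cases c, simp_all)
qed

lemma is_splitting_ex1:
  assumes "L0 \<in> set v" shows "\<exists>!p. is_splitting v p"
proof -
  obtain ys zs where v: "v = ys @ L0 # zs" "L0 \<notin> set zs"
    using split_list_last[OF assms] by blast
  have zs: "zs = replicate (length zs) L1" using v replicate_L1_iff by blast
  have ex: "is_splitting v (ys @ [L0], length zs)"
    using v zs by (simp add: is_splitting_def)
  moreover have "p = (ys @ [L0], length zs)" if split: "is_splitting v p" for p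
  proof -
    obtain a m where p: "p = (a, m)" by fastforce
    then obtain a' where a: "a = a' @ [L0]" "v = a' @ L0 # replicate m L1"
      using split p by (cases a rule: rev_cases) (auto simp: is_splitting_def)
    \<comment> \<open>Read backwards, the word shows its final block of ones up to the last zero;
      this determines \<open>m\<close> and then \<open>a\<close>.\<close>
    have "takeWhile (\<lambda>x. x \<noteq> L0) (rev v) = rev zs"
      using v by (auto simp: takeWhile_tail)
    moreover have "takeWhile (\<lambda>x. x \<noteq> L0) (rev v) = replicate m L1"
      using a(2) by (simp add: takeWhile_tail)
    ultimately have "rev (rev zs) = rev (replicate m L1)" by metis
    then have "zs = replicate m L1" by simp
    moreover from this have "a' = ys" using a(2) v(1) by simp
    ultimately show ?thesis using p a(1) by simp
  qed
  ultimately show ?thesis by blast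
qed

lemma constant_on_unit_interval:
  fixes f :: "real \<Rightarrow> complex"
  assumes "\<And>z. 0 < z \<Longrightarrow> z < 1 \<Longrightarrow> (f has_vector_derivative 0) (at z)"
  obtains c where "\<And>z. 0 < z \<Longrightarrow> z < 1 \<Longrightarrow> f z = c"
proof -
  have "(f has_vector_derivative 0) (at z within {0<..<1})" if "z \<in> {0<..<1}" for z
    using assms[of z] that by (auto intro: has_vector_derivative_at_within)
  then obtain c where "\<And>z. z \<in> {0<..<1} \<Longrightarrow> f z = c"
    using has_vector_derivative_zero_constant[of "{0<..<1::real}" f] by auto
  then show ?thesis using that[of c] by simp
qed

lemma connection_mat_eq:
  "x \<cdot>\<^sub>m word_op L0 w + y \<cdot>\<^sub>m word_op L1 w
     = word_mat w (\<lambda>v. x * (if v = [L0] then 1 else 0) + y * (if v = [L1] then 1 else 0))"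
  by (simp add: word_op_eq word_mat_smult word_mat_add)

lemma mat_power_eq:
  "mat_power (length w + 1) x (word_op L1 w)
     = word_mat w (\<lambda>v. if L0 \<in> set v then 0 else complex_of_real (ln x) ^ length v / fact (length v))"
  unfolding mat_power_def mat_series_word_op ..

subsection \<open>Uniqueness of the normalized solution\<close>

lemma normalized_solutionD:
  assumes "normalized_solution d N0 N1 G"
  shows "0 < z \<Longrightarrow> z < 1 \<Longrightarrow> G z \<in> carrier_mat d d"
    and "0 < z \<Longrightarrow> z < 1 \<Longrightarrow> i < d \<Longrightarrow> j < d \<Longrightarrow>
      ((\<lambda>x. G x $$ (i, j)) has_vector_derivative
         (((complex_of_real (omega L0 z) \<cdot>\<^sub>m N0 + complex_of_real (omega L1 z) \<cdot>\<^sub>m N1) * G z)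
            $$ (i, j))) (at z)"
    and "i < d \<Longrightarrow> j < d \<Longrightarrow>
      ((\<lambda>z. (G z * mat_power d (1 - z) N1) $$ (i, j)) \<longlongrightarrow> (1\<^sub>m d :: complex mat) $$ (i, j)) (at_left 1)"
    and "\<not> (0 < z \<and> z < 1) \<Longrightarrow> G z = 0\<^sub>m d d"
  using assms unfolding normalized_solution_def by blast+

text \<open>The difference of two solutions satisfies the same linear equation, and its product with
  the unipotent lower triangular matrix \<open>Q\<close> tends to zero at 1. This limit takes the
  place of an initial condition.\<close>

lemma normalized_solution_unique:
  assumes G: "normalized_solution (length w + 1) (word_op L0 w) (word_op L1 w) G"
    and H: "normalized_solution (length w + 1) (word_op L0 w) (word_op L1 w) H"
  shows "G = H"
proof -
  let ?d = "length w + 1"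
  define A where "A z = complex_of_real (omega L0 z) \<cdot>\<^sub>m word_op L0 w
       + complex_of_real (omega L1 z) \<cdot>\<^sub>m word_op L1 w" for z
  define Q where "Q z = mat_power ?d (1 - z) (word_op L1 w)" for z
  define D where "D i j z = G z $$ (i, j) - H z $$ (i, j)" for i j z
  have cA: "A z \<in> carrier_mat ?d ?d" and A0: "i \<le> k \<Longrightarrow> i < ?d \<Longrightarrow> k < ?d \<Longrightarrow> A z $$ (i, k) = 0" for z i k
    by (auto simp: A_def connection_mat_eq word_mat_entry subword_self)
  have cQ: "Q z \<in> carrier_mat ?d ?d"
    and Q0: "k < j \<Longrightarrow> j < ?d \<Longrightarrow> Q z $$ (k, j) = 0"
    and Q1: "j < ?d \<Longrightarrow> Q z $$ (j, j) = 1" for z k j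
    unfolding Q_def mat_power_eq by (auto simp: word_mat_entry subword_self)
  have car: "G z \<in> carrier_mat ?d ?d" "H z \<in> carrier_mat ?d ?d" if "0 < z" "z < 1" for z
    using normalized_solutionD(1) G H that by blast+
  have prod: "(X * Y) $$ (i, j) = (\<Sum>k<?d. X $$ (i, k) * Y $$ (k, j))"
    if "X \<in> carrier_mat ?d ?d" "Y \<in> carrier_mat ?d ?d" "i < ?d" "j < ?d" for X Y :: "complex mat" and i j
    using that by (simp add: scalar_prod_def atLeast0LessThan)
  have deriv: "(D i j has_vector_derivative (\<Sum>k<?d. A z $$ (i, k) * D k j z)) (at z)"
    if "0 < z" "z < 1" "i < ?d" "j < ?d" for i j z
  proof -
    have "((\<lambda>x. G x $$ (i, j)) has_vector_derivative (A z * G z) $$ (i, j)) (at z)"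
      "((\<lambda>x. H x $$ (i, j)) has_vector_derivative (A z * H z) $$ (i, j)) (at z)"
      unfolding A_def using that
      by (rule normalized_solutionD(2)[OF G], rule normalized_solutionD(2)[OF H])
    then have "(D i j has_vector_derivative (A z * G z) $$ (i, j) - (A z * H z) $$ (i, j)) (at z)"
      unfolding D_def by (rule has_vector_derivative_diff)
    then show ?thesis
      unfolding D_def right_diff_distrib sum_subtractf
        prod[OF cA car(1)[OF that(1,2)] that(3,4)] prod[OF cA car(2)[OF that(1,2)] that(3,4)] .
  qed
  have lim: "((\<lambda>z. \<Sum>k<?d. D i k z * Q z $$ (k, j)) \<longlongrightarrow> 0) (at_left 1)"
    if "i < ?d" "j < ?d" for i j
  proof -
    have "((\<lambda>z. (G z * Q z) $$ (i, j)) \<longlongrightarrow> 1\<^sub>m ?d $$ (i, j)) (at_left 1)"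
      "((\<lambda>z. (H z * Q z) $$ (i, j)) \<longlongrightarrow> 1\<^sub>m ?d $$ (i, j)) (at_left 1)"
      unfolding Q_def using that
      by (rule normalized_solutionD(3)[OF G], rule normalized_solutionD(3)[OF H])
    then have "((\<lambda>z. (G z * Q z) $$ (i, j) - (H z * Q z) $$ (i, j)) \<longlongrightarrow> 0) (at_left 1)"
      using tendsto_diff by fastforce
    moreover have "eventually (\<lambda>z. (G z * Q z) $$ (i, j) - (H z * Q z) $$ (i, j)
        = (\<Sum>k<?d. D i k z * Q z $$ (k, j))) (at_left 1)"
      using eventually_at_left_real[of 0 1, simplified]
    proof eventually_elim
      case (elim z)
      then show ?case
        unfolding D_def left_diff_distrib sum_subtractf
        by (simp only: greaterThanLessThan_iff prod[OF car(1) cQ that] prod[OF car(2) cQ that])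
    qed
    ultimately show ?thesis by (rule Lim_transform_eventually)
  qed
  \<comment> \<open>The connection matrix is strictly lower triangular: once the rows above row \<open>i\<close> vanish,
     row \<open>i\<close> is constant, and the limit condition kills it column by column from the right.\<close>
  have D0: "\<forall>j<?d. \<forall>z. 0 < z \<longrightarrow> z < 1 \<longrightarrow> D i j z = 0" if "i < ?d" for i
    using that
  proof (induction i rule: less_induct)
    case (less i)
    have "\<exists>c. \<forall>z. 0 < z \<longrightarrow> z < 1 \<longrightarrow> D i j z = c" if "j < ?d" for j
    proof -
      have "(D i j has_vector_derivative 0) (at z)" if z: "0 < z" "z < 1" for z
      proof -
        have "(\<Sum>k<?d. A z $$ (i, k) * D k j z) = 0"
        proof (intro sum.neutral ballI)
          fix k assume k: "k \<in> {..<?d}"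
          show "A z $$ (i, k) * D k j z = 0"
            using less.IH[of k] A0[of i k z] k less.prems \<open>j < ?d\<close> z by (cases "k < i") auto
        qed
        then show ?thesis using deriv[OF z less.prems \<open>j < ?d\<close>] by simp
      qed
      then show ?thesis using constant_on_unit_interval[of "D i j"] by metis
    qed
    then obtain c where c: "\<And>j z. j < ?d \<Longrightarrow> 0 < z \<Longrightarrow> z < 1 \<Longrightarrow> D i j z = c j" by metis
    have "j < ?d \<longrightarrow> c j = 0" for j
    proof (induction "?d - j" arbitrary: j rule: less_induct)
      case (less j)
      show ?case
      proof
        assume j: "j < ?d"
        have "eventually (\<lambda>z. (\<Sum>k<?d. D i k z * Q z $$ (k, j)) = c j) (at_left 1)"
          using eventually_at_left_real[of 0 1, simplified]
        proof eventually_elim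
          case (elim z)
          \<comment> \<open>The triangular shape of \<open>Q\<close> removes the columns left of j,
            the induction hypothesis those right of it. The diagonal entry of \<open>Q\<close> is 1,
            so the constant itself must tend to zero.\<close>
          have "(\<Sum>k<?d. D i k z * Q z $$ (k, j)) = (\<Sum>k\<in>{j}. D i k z * Q z $$ (k, j))"
          proof (intro sum.mono_neutral_right ballI)
            fix k assume k: "k \<in> {..<?d} - {j}"
            show "D i k z * Q z $$ (k, j) = 0"
            proof (cases "k < j")
              case False
              then have "c k = 0" using less.hyps[of k] k j by auto
              then show ?thesis using c[of k z] elim k by simp
            qed (use Q0 j in simp)
          qed (use j in auto)
          then show ?case using c[of j z] Q1 elim j by simp
        qed
        then have "((\<lambda>z. c j) \<longlongrightarrow> 0) (at_left (1::real))"
          using lim[OF \<open>i < ?d\<close> j] by (rule Lim_transform_eventually[rotated])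
        then show "c j = 0" by (simp add: tendsto_const_iff)
      qed
    qed
    then show ?case by (simp add: c)
  qed
  show "G = H"
  proof
    fix z
    show "G z = H z"
    proof (cases "0 < z \<and> z < 1")
      case True
      show ?thesis
      proof (rule eq_matI)
        fix i j assume "i < dim_row (H z)" "j < dim_col (H z)"
        then have "i < ?d" "j < ?d" using car[of z] True by (metis carrier_matD)+
        then have "D i j z = 0" using D0 True by metis
        then show "G z $$ (i, j) = H z $$ (i, j)" by (simp add: D_def)
      qed (use car[of z] True in \<open>metis carrier_matD\<close>)+
    next
      case False
      then show ?thesis using normalized_solutionD(4) G H by metis
    qed
  qed
qed

subsection \<open>One-variable iterated integrals\<close>

text \<open>The unsigned iterated integral from z to 1. For nonempty words of ones that integral
  diverges, and the branch without a zero uses the iterated integral from 0 to z instead. Leaving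
  the signs to \<open>word_sign\<close> keeps all values on the unit interval nonnegative.\<close>

fun polylog :: "letter list \<Rightarrow> real \<Rightarrow> real" where
  "polylog [] z = 1"
| "polylog (c # u) z =
     (if L0 \<in> set (c # u) then (LBINT t:{z<..<1}. omega c t * polylog u t)
      else (- ln (1 - z)) ^ length (c # u) / fact (length (c # u)))"

declare polylog.simps(2) [simp del]

lemma polylog_ones:
  "L0 \<notin> set v \<Longrightarrow> polylog v z = (- ln (1 - z)) ^ length v / fact (length v)"
  by (cases v) (simp_all add: polylog.simps)

lemma polylog_zero:
  "L0 \<in> set (c # u) \<Longrightarrow> polylog (c # u) z = (LBINT t:{z<..<1}. omega c t * polylog u t)"
  by (simp add: polylog.simps)

lemma omega_measurable [measurable]: "omega c \<in> borel_measurable borel"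
proof (cases c)
  case L0
  then have "omega c = (\<lambda>t. 1 / t)" by (simp add: fun_eq_iff)
  then show ?thesis by simp
next
  case L1
  then have "omega c = (\<lambda>t. 1 / (1 - t))" by (simp add: fun_eq_iff)
  then show ?thesis by simp
qed

lemma polylog_measurable [measurable]: "polylog v \<in> borel_measurable borel"
proof (induction v)
  case Nil
  have "polylog [] = (\<lambda>z. 1)" by (simp add: fun_eq_iff)
  then show ?case by simp
next
  case (Cons c u)
  note [measurable] = Cons
  show ?case
  proof (cases "L0 \<in> set (c # u)")
    case True
    \<comment> \<open>With the bound z moved into the integrand, the integrand is jointly measurable
      in z and t, and integrating over t preserves measurability even where the integral takes its
      default value.\<close>
    have "polylog (c # u)
        = (\<lambda>z. \<integral>t. (if z < t \<and> t < 1 then omega c t * polylog u t else 0) \<partial>lborel)"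
      unfolding polylog_zero[OF True] set_lebesgue_integral_def fun_eq_iff
      by (intro allI Bochner_Integration.integral_cong) (auto simp: indicator_def)
    moreover have "\<dots> \<in> borel_measurable borel" by measurable
    ultimately show ?thesis by simp
  next
    case False
    have "polylog (c # u) = (\<lambda>z. (- ln (1 - z)) ^ length (c # u) / fact (length (c # u)))"
      unfolding polylog_ones[OF False] fun_eq_iff by simp
    moreover have "\<dots> \<in> borel_measurable borel" by measurable
    ultimately show ?thesis by simp
  qed
qed

lemma omega_nonneg: "0 < t \<Longrightarrow> t < 1 \<Longrightarrow> 0 \<le> omega c t"
  by (cases c) auto

lemma continuous_on_omega: "continuous_on {0<..<1} (omega c)"
proof -
  have "continuous_on {0<..<1::real} (\<lambda>t. 1 / t)" "continuous_on {0<..<1::real} (\<lambda>t. 1 / (1 - t))"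
    by (auto intro!: continuous_intros)
  moreover have "omega L0 = (\<lambda>t. 1 / t)" "omega L1 = (\<lambda>t. 1 / (1 - t))"
    by (simp_all add: fun_eq_iff)
  ultimately show ?thesis by (cases c) simp_all
qed

text \<open>Every \<open>polylog v\<close> with a zero in \<open>v\<close> is bounded by a multiple of \<open>majorant\<close>: its kernel
  \<open>- 2 majorant'\<close> dominates \<open>majorant / z\<close>, \<open>majorant / (1 - z)\<close> and \<open>1 / (z \<surd>(1 - z))\<close>, so the bound
  reproduces itself under iterated integration.\<close>

definition majorant :: "real \<Rightarrow> real" where "majorant z = sqrt ((1 - z) / z)"

definition majorant_kernel :: "real \<Rightarrow> real" where
  "majorant_kernel z = 1 / (z\<^sup>2 * majorant z)"

lemma majorant_pos: "0 < z \<Longrightarrow> z < 1 \<Longrightarrow> 0 < majorant z"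
  by (simp add: majorant_def)

lemma majorant_square: "0 < z \<Longrightarrow> z < 1 \<Longrightarrow> (majorant z)\<^sup>2 = (1 - z) / z"
  by (simp add: majorant_def)

lemma majorant_deriv:
  assumes "0 < z" "z < 1"
  shows "((\<lambda>z. - 2 * majorant z) has_real_derivative majorant_kernel z) (at z)"
proof -
  have q: "((\<lambda>z. (1 - z) / z) has_real_derivative (- 1 / z\<^sup>2)) (at z)"
    using assms by (auto intro!: derivative_eq_intros simp: field_simps power2_eq_square)
  have "((\<lambda>z. sqrt ((1 - z) / z)) has_real_derivative (inverse (sqrt ((1 - z) / z)) / 2) * (- 1 / z\<^sup>2)) (at z)"
    by (rule DERIV_chain2[OF DERIV_real_sqrt q]) (use assms in simp)
  then have "((\<lambda>z. - 2 * majorant z) has_real_derivative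
      - 2 * ((inverse (majorant z) / 2) * (- 1 / z\<^sup>2))) (at z)"
    unfolding majorant_def by (rule DERIV_cmult)
  then show ?thesis by (simp add: majorant_kernel_def field_simps)
qed

text \<open>The kernel has an inverse square root singularity at 1. Since it is nonnegative, the
  limits of its primitive at both ends yield integrability together with the value.\<close>

lemma majorant_kernel_integral:
  assumes z: "0 < z" "z < 1"
  shows "set_integrable lborel {z<..<1} majorant_kernel"
    and "(LBINT t:{z<..<1}. majorant_kernel t) = 2 * majorant z"
proof -
  have c: "isCont majorant_kernel x" if "ereal z < ereal x" "ereal x < ereal 1" for x
  proof -
    have "continuous_on {0<..<1} majorant_kernel"
      unfolding majorant_kernel_def[abs_def] majorant_def[abs_def]
      by (auto intro!: continuous_intros)
    then show ?thesis using that z by (simp add: continuous_on_eq_continuous_at)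
  qed
  \<comment> \<open>The real \<open>sqrt\<close> is extended to negative arguments and is continuous
    at 0, so the primitive is continuous at 1 as well, although its derivative is unbounded
    there.\<close>
  have cm: "continuous (at x) (\<lambda>z. - 2 * majorant z)" if "0 < x" for x
    unfolding majorant_def using that by (intro continuous_intros) auto
  have A: "(((\<lambda>z. - 2 * majorant z) \<circ> real_of_ereal) \<longlongrightarrow> - 2 * majorant z) (at_right (ereal z))"
    unfolding ereal_tendsto_simps using cm[of z] z
    by (auto simp: continuous_at intro: tendsto_within_subset[where S = UNIV])
  have B: "(((\<lambda>z. - 2 * majorant z) \<circ> real_of_ereal) \<longlongrightarrow> - 2 * majorant 1) (at_left (ereal 1))"
    unfolding ereal_tendsto_simps using cm[of 1]
    by (auto simp: continuous_at intro: tendsto_within_subset[where S = UNIV])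
  have nn: "AE x in lborel. ereal z < ereal x \<longrightarrow> ereal x < ereal 1 \<longrightarrow> 0 \<le> majorant_kernel x"
    using z by (auto simp: majorant_kernel_def majorant_def intro!: AE_I2)
  have d: "DERIV (\<lambda>z. - 2 * majorant z) x :> majorant_kernel x"
    if "ereal z < ereal x" "ereal x < ereal 1" for x
    using that z by (intro majorant_deriv) auto
  have zl: "ereal z < ereal 1" using z by simp
  note ftc = interval_integral_FTC_nonneg[OF zl d c nn A B]
  show "set_integrable lborel {z<..<1} majorant_kernel"
    using ftc(1) by simp
  show "(LBINT t:{z<..<1}. majorant_kernel t) = 2 * majorant z"
    using ftc(2) z by (simp add: interval_lebesgue_integral_def majorant_def)
qed

section \<open>Tail integrals: bounds and derivatives\<close>

lemma tail_integral_bound: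
  assumes g [measurable]: "g \<in> borel_measurable borel"
    and bd: "\<And>t. 0 < t \<Longrightarrow> t < 1 \<Longrightarrow> 0 \<le> g t \<and> g t \<le> C * majorant_kernel t"
    and z: "0 < z" "z < 1"
  shows "set_integrable lborel {z<..<1} g"
    and "0 \<le> (LBINT t:{z<..<1}. g t)"
    and "(LBINT t:{z<..<1}. g t) \<le> 2 * C * majorant z"
proof -
  have K: "set_integrable lborel {z<..<1} (\<lambda>t. C * majorant_kernel t)"
    using majorant_kernel_integral(1)[OF z] by simp
  show i: "set_integrable lborel {z<..<1} g"
  proof (rule set_integrable_bound[OF K])
    show "set_borel_measurable lborel {z<..<1} g"
      unfolding set_borel_measurable_def by measurable
    show "AE t in lborel. t \<in> {z<..<1} \<longrightarrow> norm (g t) \<le> norm (C * majorant_kernel t)"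
    proof (intro AE_I2 impI)
      fix t assume "t \<in> {z<..<1}"
      then show "norm (g t) \<le> norm (C * majorant_kernel t)" using bd[of t] z by auto
    qed
  qed
  show "0 \<le> (LBINT t:{z<..<1}. g t)"
    unfolding set_lebesgue_integral_def
    using bd z by (intro Bochner_Integration.integral_nonneg) (auto simp: indicator_def)
  have "(LBINT t:{z<..<1}. g t) \<le> (LBINT t:{z<..<1}. C * majorant_kernel t)"
    using bd z by (intro set_integral_mono[OF i K]) auto
  then show "(LBINT t:{z<..<1}. g t) \<le> 2 * C * majorant z"
    using majorant_kernel_integral(2)[OF z] by simp
qed

text \<open>The upper end 1 may be singular, so the moving tail is written as a fixed tail from a <
  z minus an integral over a compact interval, to which the fundamental theorem applies.\<close>

lemma tail_integral_deriv:
  fixes g :: "real \<Rightarrow> real"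
  assumes int: "\<And>z. 0 < z \<Longrightarrow> z < 1 \<Longrightarrow> set_integrable lborel {z<..<1} g"
    and cont: "continuous_on {0<..<1} g"
    and z: "0 < z" "z < 1"
  shows "((\<lambda>z. LBINT t:{z<..<1}. g t) has_real_derivative - g z) (at z)"
proof -
  obtain a b where ab: "0 < a" "a < z" "z < b" "b < 1"
    using dense[OF z(1)] dense[OF z(2)] by blast
  have c: "continuous_on {a..b} g"
    using ab by (intro continuous_on_subset[OF cont]) auto
  have "((\<lambda>u. LBINT t=a..u. g t) has_vector_derivative g z) (at z within {a..b})"
    using ab c by (intro interval_integral_FTC2) auto
  then have "((\<lambda>u. LBINT t=a..u. g t) has_real_derivative g z) (at z)"
    using ab by (simp add: has_real_derivative_iff_has_vector_derivative at_within_Icc_at)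
  then have d: "((\<lambda>u. (LBINT t:{a<..<1}. g t) - (LBINT t=a..u. g t)) has_real_derivative 0 - g z) (at z)"
    by (intro derivative_intros)
  have eq: "(LBINT t:{a<..<1}. g t) - (LBINT t=a..u. g t) = (LBINT t:{u<..<1}. g t)"
    if u: "u \<in> {a<..<b}" for u
  proof -
    have i1: "set_integrable lborel {a<..u} g"
      by (rule set_integrable_subset[OF int[of a]]) (use ab u in auto)
    have i2: "set_integrable lborel {u<..<1} g" using ab u by (intro int) auto
    have un: "{a<..u} \<union> {u<..<1} = {a<..<1}" using ab u by auto
    have "(LBINT t:{a<..<1}. g t) = (LBINT t:{a<..u}. g t) + (LBINT t:{u<..<1}. g t)"
      unfolding un[symmetric] by (rule set_integral_Un[OF _ i1 i2]) auto
    moreover have "(LBINT t=a..u. g t) = (LBINT t:{a<..u}. g t)"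
      using u by (simp add: interval_integral_Ioc)
    ultimately show ?thesis by simp
  qed
  have "((\<lambda>z. LBINT t:{z<..<1}. g t) has_real_derivative 0 - g z) (at z)"
    by (rule has_field_derivative_transform_within_open[OF d, of "{a<..<b}"])
       (use ab eq in auto)
  then show ?thesis by simp
qed

text \<open>One term of the exponential series is at most the whole series. At x = - log (1 - t) / 2
  the exponential is 1 / sqrt (1 - t), and halving the logarithm costs the factor 2^m.\<close>

lemma log_power_bound:
  assumes "0 < t" "t < 1"
  shows "(- ln (1 - t)) ^ m / fact m \<le> 2 ^ m / sqrt (1 - t)"
proof -
  define x where "x = - ln (1 - t) / 2"
  have x: "0 \<le> x" using assms by (simp add: x_def)
  have "x ^ m / fact m \<le> (\<Sum>n. x ^ n /\<^sub>R fact n)"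
  proof -
    have "(\<Sum>n\<in>{m}. x ^ n /\<^sub>R fact n) \<le> (\<Sum>n. x ^ n /\<^sub>R fact n)"
      using x by (intro sum_le_suminf summable_exp_generic) auto
    then show ?thesis by (simp add: field_simps)
  qed
  also have "\<dots> = exp x" by (simp add: exp_def)
  also have "\<dots> = 1 / sqrt (1 - t)"
  proof -
    have "x = - ln (sqrt (1 - t))" using assms by (simp add: x_def ln_sqrt)
    then show ?thesis using assms by (simp add: exp_minus inverse_eq_divide)
  qed
  finally have "2 ^ m * (x ^ m / fact m) \<le> 2 ^ m * (1 / sqrt (1 - t))"
    by (intro mult_left_mono) auto
  moreover have "(- ln (1 - t)) ^ m = 2 ^ m * x ^ m"
    by (simp add: x_def flip: power_mult_distrib)
  ultimately show ?thesis by simp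
qed

text \<open>The bound is put on the integrand, not on \<open>polylog\<close>, so that one induction
  also covers \<open>u\<close> consisting of ones: there \<open>polylog u\<close> may be unbounded
  at 1 and is not controlled by \<open>majorant\<close>, but the letter in front is a zero and the
  product is still below the kernel.\<close>

lemma kernel_bound:
  assumes "L0 \<in> set (c # u)"
  shows "\<exists>C. 0 \<le> C \<and> (\<forall>t. 0 < t \<longrightarrow> t < 1 \<longrightarrow>
     0 \<le> omega c t * polylog u t \<and> omega c t * polylog u t \<le> C * majorant_kernel t)"
  using assms
proof (induction u arbitrary: c rule: length_induct)
  case (1 u)
  show ?case
  proof (cases "L0 \<in> set u")
    case False
    then have c: "c = L0" using 1 by simp
    have "0 \<le> omega c t * polylog u t \<and> omega c t * polylog u t \<le> 2 ^ length u * majorant_kernel t"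
      if t: "0 < t" "t < 1" for t
    proof -
      have "t * majorant t = sqrt (t * (1 - t))"
      proof -
        have "(t * majorant t)\<^sup>2 = t\<^sup>2 * ((1 - t) / t)"
          by (simp only: power_mult_distrib majorant_square[OF t])
        also have "\<dots> = t * (1 - t)" using t by (simp add: power2_eq_square)
        finally have "(t * majorant t)\<^sup>2 = t * (1 - t)" .
        then show ?thesis using t majorant_pos[OF t] by (metis less_eq_real_def mult_nonneg_nonneg real_sqrt_unique)
      qed
      also have "\<dots> \<le> sqrt (1 - t)" using t by (simp add: mult_left_le_one_le)
      finally have le: "t * majorant t \<le> sqrt (1 - t)" .
      have "omega c t * polylog u t \<le> 1 / t * (2 ^ length u / sqrt (1 - t))"
        unfolding polylog_ones[OF False] c omega.simps
        by (intro mult_left_mono log_power_bound t) (use t in simp)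
      also have "\<dots> = 2 ^ length u * (1 / (t * sqrt (1 - t)))" by simp
      also have "\<dots> \<le> 2 ^ length u * (1 / (t * (t * majorant t)))"
        using t majorant_pos[OF t] le by (intro mult_left_mono divide_left_mono mult_pos_pos) auto
      also have "\<dots> = 2 ^ length u * majorant_kernel t"
        by (simp add: majorant_kernel_def power2_eq_square mult.assoc)
      finally show ?thesis
        using t by (auto simp: c polylog_ones[OF False] intro!: divide_nonneg_nonneg)
    qed
    then show ?thesis by (intro exI[of _ "2 ^ length u"]) simp
  next
    case True
    then obtain c' u' where u: "u = c' # u'" by (cases u) auto
    then obtain C where C: "0 \<le> C" "\<And>t. 0 < t \<Longrightarrow> t < 1 \<Longrightarrow>
       0 \<le> omega c' t * polylog u' t \<and> omega c' t * polylog u' t \<le> C * majorant_kernel t"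
      using 1(1)[rule_format, of u' c'] True by auto
    have "0 \<le> omega c t * polylog u t \<and> omega c t * polylog u t \<le> 2 * C * majorant_kernel t"
      if t: "0 < t" "t < 1" for t
    proof -
      have p: "0 \<le> polylog u t" "polylog u t \<le> 2 * C * majorant t"
        using tail_integral_bound[of "\<lambda>t. omega c' t * polylog u' t", OF _ C(2) t]
          polylog_zero[of c' u'] True u by auto
      have B: "0 < majorant t" using majorant_pos[OF t] .
      \<comment> \<open>The square of t * \<open>majorant\<close> t is t * (1 - t), which cancels
        the pole of either letter.\<close>
      have k: "omega c t * majorant t \<le> majorant_kernel t"
      proof -
        have "omega c t * (t\<^sup>2 * (majorant t)\<^sup>2) \<le> 1"
        proof -
          have "t\<^sup>2 * (majorant t)\<^sup>2 = t * (1 - t)"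
            unfolding majorant_square[OF t] using t by (simp add: power2_eq_square)
          then show ?thesis using t by (cases c) auto
        qed
        then have "(omega c t * majorant t) * (t\<^sup>2 * majorant t) \<le> 1"
          by (simp add: power2_eq_square algebra_simps)
        then show ?thesis using t B by (simp add: majorant_kernel_def pos_le_divide_eq)
      qed
      have "omega c t * polylog u t \<le> omega c t * (2 * C * majorant t)"
        by (intro mult_left_mono p omega_nonneg t)
      also have "\<dots> = 2 * C * (omega c t * majorant t)" by simp
      also have "\<dots> \<le> 2 * C * majorant_kernel t" using C(1) k by (intro mult_left_mono) auto
      finally show ?thesis using p(1) omega_nonneg[OF t] by simp
    qed
    then show ?thesis using C(1) by (intro exI[of _ "2 * C"]) simp
  qed
qed

lemma kernel_integrable:
  assumes "L0 \<in> set (c # u)" "0 < z" "z < 1"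
  shows "set_integrable lborel {z<..<1} (\<lambda>t. omega c t * polylog u t)"
proof -
  obtain C where C: "\<And>t. 0 < t \<Longrightarrow> t < 1 \<Longrightarrow>
       0 \<le> omega c t * polylog u t \<and> omega c t * polylog u t \<le> C * majorant_kernel t"
    using kernel_bound[OF assms(1)] by auto
  show ?thesis by (rule tail_integral_bound(1)[OF _ C assms(2,3)]) auto
qed

lemma polylog_bound:
  assumes "L0 \<in> set v"
  shows "\<exists>C\<ge>0. \<forall>z. 0 < z \<longrightarrow> z < 1 \<longrightarrow> polylog v z \<le> C * majorant z"
proof -
  obtain c u where v: "v = c # u" using assms by (cases v) auto
  obtain C where C: "0 \<le> C" "\<And>t. 0 < t \<Longrightarrow> t < 1 \<Longrightarrow>
       0 \<le> omega c t * polylog u t \<and> omega c t * polylog u t \<le> C * majorant_kernel t"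
    using kernel_bound[of c u] assms v by auto
  have "polylog v z \<le> 2 * C * majorant z" if "0 < z" "z < 1" for z
    using tail_integral_bound(3)[of "\<lambda>t. omega c t * polylog u t", OF _ C(2) that]
      polylog_zero[of c u] assms v by auto
  then show ?thesis using C(1) by (intro exI[of _ "2 * C"]) simp
qed

lemma polylog_nonneg:
  assumes "0 < z" "z < 1"
  shows "0 \<le> polylog v z"
proof (cases "L0 \<in> set v")
  case True
  then obtain c u where v: "v = c # u" by (cases v) auto
  obtain C where C: "\<And>t. 0 < t \<Longrightarrow> t < 1 \<Longrightarrow>
       0 \<le> omega c t * polylog u t \<and> omega c t * polylog u t \<le> C * majorant_kernel t"
    using kernel_bound[of c u] True v by auto
  show ?thesis
    using tail_integral_bound(2)[of "\<lambda>t. omega c t * polylog u t", OF _ C assms]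
      polylog_zero[of c u] True v by auto
next
  case False
  then show ?thesis using assms by (auto simp: polylog_ones intro!: divide_nonneg_nonneg)
qed

lemma polylog_ones_deriv:
  assumes "L0 \<notin> set (c # u)" "z < 1"
  shows "(polylog (c # u) has_real_derivative omega c z * polylog u z) (at z)"
proof -
  have c: "c = L1" using assms(1) by (cases c) auto
  have u: "L0 \<notin> set u" using assms(1) by simp
  have eq: "polylog (c # u) = (\<lambda>z. (- ln (1 - z)) ^ Suc (length u) / fact (Suc (length u)))"
    using polylog_ones[OF assms(1)] by (simp add: fun_eq_iff)
  have d: "((\<lambda>z. - ln (1 - z)) has_real_derivative 1 / (1 - z)) (at z)"
    using assms(2) by (auto intro!: derivative_eq_intros)
  have "((\<lambda>z. (- ln (1 - z)) ^ Suc (length u) / fact (Suc (length u))) has_real_derivative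
      (of_nat (Suc (length u)) * ((- ln (1 - z)) ^ length u) * (1 / (1 - z))) / fact (Suc (length u))) (at z)"
    using DERIV_cdivide[OF DERIV_power[OF d, of "Suc (length u)"], of "fact (Suc (length u))"]
    by (simp add: mult_ac del: fact_Suc of_nat_Suc)
  also have "(of_nat (Suc (length u)) * ((- ln (1 - z)) ^ length u) * (1 / (1 - z))) / fact (Suc (length u))
     = omega c z * polylog u z"
    unfolding polylog_ones[OF u] c fact_Suc by simp
  finally show ?thesis unfolding eq .
qed

text \<open>The derivative at \<open>c # u\<close> requires a continuous integrand, hence continuity
  for \<open>u\<close>, and in turn gives continuity for \<open>c # u\<close>. The fact
  \<open>d\<close> therefore takes continuity as a premise and serves both claims.\<close>

lemma polylog_continuous: "continuous_on {0<..<1} (polylog v)"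
  and polylog_zero_deriv:
    "L0 \<in> set (c # u) \<Longrightarrow> 0 < z \<Longrightarrow> z < 1 \<Longrightarrow>
       (polylog (c # u) has_real_derivative - (omega c z * polylog u z)) (at z)"
proof -
  have d: "(polylog (c # u) has_real_derivative - (omega c z * polylog u z)) (at z)"
    if "continuous_on {0<..<1} (polylog u)" "L0 \<in> set (c # u)" "0 < z" "z < 1" for c u z
  proof -
    have "((\<lambda>z. LBINT t:{z<..<1}. omega c t * polylog u t) has_real_derivative
        - (omega c z * polylog u z)) (at z)"
      using that continuous_on_omega[of c]
      by (intro tail_integral_deriv kernel_integrable continuous_on_mult) auto
    moreover have "polylog (c # u) = (\<lambda>z. LBINT t:{z<..<1}. omega c t * polylog u t)"
      using polylog_zero[OF that(2)] by (simp add: fun_eq_iff)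
    ultimately show ?thesis by simp
  qed
  show cont: "continuous_on {0<..<1} (polylog v)" for v
  proof (induction v)
    case Nil
    have "polylog [] = (\<lambda>z. 1)" by (simp add: fun_eq_iff)
    then show ?case by simp
  next
    case (Cons c u)
    show ?case
    proof (intro continuous_at_imp_continuous_on ballI)
      fix z :: real assume "z \<in> {0<..<1}"
      then show "isCont (polylog (c # u)) z"
        using d[OF Cons, of c z] polylog_ones_deriv[of c u z]
        by (cases "L0 \<in> set (c # u)") (auto intro: DERIV_isCont)
    qed
  qed
  show "L0 \<in> set (c # u) \<Longrightarrow> 0 < z \<Longrightarrow> z < 1 \<Longrightarrow>
       (polylog (c # u) has_real_derivative - (omega c z * polylog u z)) (at z)"
    using d[OF cont] .
qed

section \<open>Integrability on the unit interval and logarithmic limits at 1\<close>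

lemma sqrt_inverse_integrable: "set_integrable lborel {0<..<1} (\<lambda>z. 1 / sqrt z)"
proof -
  have d: "DERIV (\<lambda>z. 2 * sqrt z) x :> 1 / sqrt x" if "ereal 0 < ereal x" "ereal x < ereal 1" for x
    using that by (auto intro!: derivative_eq_intros simp: field_simps)
  have c: "isCont (\<lambda>z. 1 / sqrt z) x" if "ereal 0 < ereal x" "ereal x < ereal 1" for x
    using that by (intro continuous_intros) auto
  have nn: "AE x in lborel. ereal 0 < ereal x \<longrightarrow> ereal x < ereal 1 \<longrightarrow> 0 \<le> 1 / sqrt x"
    by auto
  have cm: "isCont (\<lambda>z. 2 * sqrt z) x" for x by (intro continuous_intros)
  have A: "(((\<lambda>z. 2 * sqrt z) \<circ> real_of_ereal) \<longlongrightarrow> 2 * sqrt 0) (at_right (ereal 0))"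
    unfolding ereal_tendsto_simps using cm[of 0]
    by (auto simp: continuous_at intro: tendsto_within_subset[where S = UNIV])
  have B: "(((\<lambda>z. 2 * sqrt z) \<circ> real_of_ereal) \<longlongrightarrow> 2 * sqrt 1) (at_left (ereal 1))"
    unfolding ereal_tendsto_simps using cm[of 1]
    by (auto simp: continuous_at intro: tendsto_within_subset[where S = UNIV])
  have zl: "ereal 0 < ereal 1" by simp
  show ?thesis
    using interval_integral_FTC_nonneg(1)[OF zl d c nn A B] by simp
qed

text \<open>With x = - log (1 - z) / 2 the expression is 2^j * x^j * exp (- x), and x tends to
  infinity.\<close>

lemma ln_power_mult_sqrt_tendsto:
  "((\<lambda>z. \<bar>ln (1 - z)\<bar> ^ j * sqrt (1 - z)) \<longlongrightarrow> 0) (at_left (1::real))"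
proof -
  have "filterlim (\<lambda>z::real. 1 - z) (at_right 0) (at_left 1)"
    unfolding filterlim_at
  proof (intro conjI)
    show "((\<lambda>z::real. 1 - z) \<longlongrightarrow> 0) (at_left 1)"
      by (auto intro!: tendsto_eq_intros)
  qed (auto simp: eventually_at_filter)
  then have "filterlim (\<lambda>z::real. ln (1 - z)) at_bot (at_left 1)"
    by (rule filterlim_compose[OF ln_at_0])
  then have "filterlim (\<lambda>z::real. - ln (1 - z)) at_top (at_left 1)"
    by (simp add: filterlim_uminus_at_top)
  then have x: "filterlim (\<lambda>z::real. (1 / 2) * (- ln (1 - z))) at_top (at_left 1)"
    by (intro filterlim_tendsto_pos_mult_at_top[OF tendsto_const]) auto
  have "((\<lambda>z::real. 2 ^ j * (((1 / 2) * (- ln (1 - z))) ^ j / exp ((1 / 2) * (- ln (1 - z))))) \<longlongrightarrow> 2 ^ j * 0) (at_left 1)"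
    by (intro tendsto_mult tendsto_const filterlim_compose[OF tendsto_power_div_exp_0 x])
  moreover have "eventually (\<lambda>z::real. 2 ^ j * (((1 / 2) * (- ln (1 - z))) ^ j / exp ((1 / 2) * (- ln (1 - z))))
      = \<bar>ln (1 - z)\<bar> ^ j * sqrt (1 - z)) (at_left 1)"
    using eventually_at_left_real[of 0 1, simplified]
  proof eventually_elim
    case (elim z)
    have e: "exp ((1 / 2) * (- ln (1 - z))) = 1 / sqrt (1 - z)"
    proof -
      have "(1 / 2) * (- ln (1 - z)) = - ln (sqrt (1 - z))" using elim by (simp add: ln_sqrt)
      then show ?thesis using elim by (simp add: exp_minus inverse_eq_divide)
    qed
    have l: "(1 / 2) * (- ln (1 - z)) = \<bar>ln (1 - z)\<bar> / 2" using elim by simp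
    show ?case unfolding e unfolding l by (simp add: power_divide)
  qed
  ultimately show ?thesis using Lim_transform_eventually by fastforce
qed

text \<open>Under s = - log (1 - z) the integral becomes that of s^m * exp (- s) / m! over the
  positive half-line. This is the source of the convention that \<open>ell\<close> is 1 on words of
  ones.\<close>

lemma polylog_ones_integral:
  assumes "L0 \<notin> set v"
  shows "set_integrable lborel {0<..<1} (polylog v)"
    and "(LBINT z:{0<..<1}. polylog v z) = 1"
proof -
  define f where "f m z = (- ln (1 - z)) ^ m / fact m" for m and z :: real
  \<comment> \<open>The primitive - exp (- s) * (sum of s^k / k! for k \<le> m) of the Gamma
    integrand, written in z. Its derivative telescopes to the top term.\<close>
  define F where "F z = - ((1 - z) * (\<Sum>k\<le>length v. f k z))" for z :: real
  have df: "DERIV (f (Suc m)) z :> f m z / (1 - z)" if "z < 1" for m z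
  proof -
    have "polylog (L1 # replicate m L1) = f (Suc m)"
      by (rule ext, subst polylog_ones) (auto simp: f_def)
    moreover have "polylog (replicate m L1) z = f m z"
      by (subst polylog_ones) (auto simp: f_def)
    ultimately show ?thesis
      using polylog_ones_deriv[of L1 "replicate m L1" z] that by simp
  qed
  have sum: "DERIV (\<lambda>z. \<Sum>k\<le>n. f k z) z :> (\<Sum>k<n. f k z) / (1 - z)" if "z < 1" for n z
  proof (induction n)
    case 0
    then show ?case by (simp add: f_def)
  next
    case (Suc n)
    show ?case using DERIV_add[OF Suc df[OF that, of n]] by (simp add: add_divide_distrib)
  qed
  have dF: "DERIV F z :> f (length v) z" if "z < 1" for z
  proof -
    have "DERIV F z :> - ((0 - 1) * (\<Sum>k\<le>length v. f k z) + (\<Sum>k<length v. f k z) / (1 - z) * (1 - z))"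
      unfolding F_def by (intro DERIV_minus DERIV_mult DERIV_diff DERIV_const DERIV_ident sum that)
    then show ?thesis using that by (simp add: lessThan_Suc_atMost[symmetric])
  qed
  have pf: "polylog v = f (length v)"
    using polylog_ones[OF assms] by (simp add: f_def fun_eq_iff)
  have d: "DERIV F x :> polylog v x" if "ereal 0 < ereal x" "ereal x < ereal 1" for x
    using that dF[of x] pf by simp
  have c: "isCont (polylog v) x" if "ereal 0 < ereal x" "ereal x < ereal 1" for x
    using polylog_continuous[of v] that by (simp add: continuous_on_eq_continuous_at)
  have nn: "AE x in lborel. ereal 0 < ereal x \<longrightarrow> ereal x < ereal 1 \<longrightarrow> 0 \<le> polylog v x"
    using polylog_nonneg by auto
  have F0: "F 0 = -1"
  proof -
    have "(\<Sum>k\<le>length v. f k 0) = (\<Sum>k\<in>{0}. f k 0)"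
      by (intro sum.mono_neutral_right) (auto simp: f_def)
    then show ?thesis by (simp add: F_def f_def)
  qed
  have A: "((F \<circ> real_of_ereal) \<longlongrightarrow> -1) (at_right (ereal 0))"
    unfolding ereal_tendsto_simps using DERIV_isCont[OF dF, of 0] F0
    by (auto simp: continuous_at intro: tendsto_within_subset[where S = UNIV])
  have f_lim: "((\<lambda>z. (1 - z) * f k z) \<longlongrightarrow> 0) (at_left 1)" for k
  proof -
    \<comment> \<open>The factor 1 - z is split into two square roots: one absorbs the logarithms,
      the other tends to zero.\<close>
    have "((\<lambda>z. sqrt (1 - z) * (\<bar>ln (1 - z)\<bar> ^ k * sqrt (1 - z)) / fact k) \<longlongrightarrow> sqrt (1 - 1) * 0 / fact k) (at_left (1::real))"
      by (intro tendsto_intros ln_power_mult_sqrt_tendsto) auto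
    moreover have "eventually (\<lambda>z. sqrt (1 - z) * (\<bar>ln (1 - z)\<bar> ^ k * sqrt (1 - z)) / fact k = (1 - z) * f k z) (at_left (1::real))"
      using eventually_at_left_real[of 0 1, simplified]
    proof eventually_elim
      case (elim z)
      have "sqrt (1 - z) * (\<bar>ln (1 - z)\<bar> ^ k * sqrt (1 - z)) = (sqrt (1 - z) * sqrt (1 - z)) * \<bar>ln (1 - z)\<bar> ^ k"
        by (simp only: mult_ac)
      also have "\<dots> = (1 - z) * (- ln (1 - z)) ^ k" using elim by simp
      finally show ?case by (simp add: f_def)
    qed
    ultimately show ?thesis using Lim_transform_eventually by fastforce
  qed
  have "((\<lambda>z. - (\<Sum>k\<le>length v. (1 - z) * f k z)) \<longlongrightarrow> - (\<Sum>k\<le>length v. 0)) (at_left 1)"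
    by (intro tendsto_minus tendsto_sum f_lim)
  then have "(F \<longlongrightarrow> 0) (at_left 1)"
    by (simp add: F_def[abs_def] sum_distrib_left)
  then have B: "((F \<circ> real_of_ereal) \<longlongrightarrow> 0) (at_left (ereal 1))"
    unfolding ereal_tendsto_simps .
  have zl: "ereal 0 < ereal 1" by simp
  note ftc = interval_integral_FTC_nonneg[OF zl d c nn A B]
  show "set_integrable lborel {0<..<1} (polylog v)" using ftc(1) by simp
  show "(LBINT z:{0<..<1}. polylog v z) = 1"
    using ftc(2) by (simp add: interval_lebesgue_integral_def)
qed

lemma polylog_integrable: "set_integrable lborel {0<..<1} (polylog v)"
proof (cases "L0 \<in> set v")
  case True
  then obtain C where C: "0 \<le> C" "\<And>z. 0 < z \<Longrightarrow> z < 1 \<Longrightarrow> polylog v z \<le> C * majorant z"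
    using polylog_bound by blast
  have i: "set_integrable lborel {0<..<1} (\<lambda>z. C * (1 / sqrt z))"
    using sqrt_inverse_integrable by (intro set_integrable_mult_right) auto
  show ?thesis
  proof (rule set_integrable_bound[OF i])
    show "set_borel_measurable lborel {0<..<1} (polylog v)"
      unfolding set_borel_measurable_def by measurable
    show "AE z in lborel. z \<in> {0<..<1} \<longrightarrow> norm (polylog v z) \<le> norm (C * (1 / sqrt z))"
    proof (intro AE_I2 impI)
      fix z :: real assume z: "z \<in> {0<..<1}"
      \<comment> \<open>Only the singularity at 0 matters for integrability, because the numerator
        sqrt (1 - z) is at most 1.\<close>
      have "majorant z \<le> 1 / sqrt z"
        using z by (auto simp: majorant_def real_sqrt_divide intro!: divide_right_mono)
      then have "C * majorant z \<le> C * (1 / sqrt z)" using C(1) by (rule mult_left_mono)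
      then show "norm (polylog v z) \<le> norm (C * (1 / sqrt z))"
        using C(1) C(2)[of z] polylog_nonneg[of z v] z by simp
    qed
  qed
qed (rule polylog_ones_integral)

section \<open>Exchanging the order of integration\<close>

lemma nn_integral_kernel:
  assumes "L0 \<in> set (c # u)" "0 < z" "z < 1"
  shows "(\<integral>\<^sup>+ t. ennreal (omega c t * polylog u t) * indicator {z<..<1} t \<partial>lborel)
     = ennreal (polylog (c # u) z)"
proof -
  have "(\<integral>\<^sup>+ t. ennreal (omega c t * polylog u t) * indicator {z<..<1} t \<partial>lborel)
      = (\<integral>\<^sup>+ t. ennreal (indicator {z<..<1} t *\<^sub>R (omega c t * polylog u t)) \<partial>lborel)"
    by (intro nn_integral_cong) (auto simp: indicator_def)
  also have "\<dots> = ennreal (LBINT t:{z<..<1}. omega c t * polylog u t)"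
    unfolding set_lebesgue_integral_def
    using kernel_integrable[OF assms] assms omega_nonneg[of _ c] polylog_nonneg[of _ u]
    by (intro nn_integral_eq_integral) (auto simp: set_integrable_def indicator_def)
  finally show ?thesis using polylog_zero[OF assms(1)] by simp
qed

lemma nn_integral_polylog:
  assumes "L0 \<in> set (c # u)"
  shows "(\<integral>\<^sup>+ s. ennreal (s * omega c s * polylog u s) * indicator {0<..<1} s \<partial>lborel)
     = (\<integral>\<^sup>+ z. ennreal (polylog (c # u) z) * indicator {0<..<1} z \<partial>lborel)"
proof -
  \<comment> \<open>Extension by zero from the triangle 0 < z < t < 1 to the plane lets both orders
    of integration run over the whole line.\<close>
  define h :: "real \<Rightarrow> real \<Rightarrow> ennreal" where
    "h z t = (if 0 < z \<and> z < t \<and> t < 1 then ennreal (omega c t * polylog u t) else 0)" for z t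
  have hm: "(\<lambda>(z, t). h z t) \<in> borel_measurable (lborel \<Otimes>\<^sub>M lborel)"
    unfolding h_def by measurable
  have "(\<integral>\<^sup>+ z. ennreal (polylog (c # u) z) * indicator {0<..<1} z \<partial>lborel)
      = (\<integral>\<^sup>+ z. \<integral>\<^sup>+ t. h z t \<partial>lborel \<partial>lborel)"
  proof (intro nn_integral_cong)
    fix z :: real
    show "ennreal (polylog (c # u) z) * indicator {0<..<1} z = (\<integral>\<^sup>+ t. h z t \<partial>lborel)"
    proof (cases "z \<in> {0<..<1}")
      case True
      have "(\<integral>\<^sup>+ t. h z t \<partial>lborel)
          = (\<integral>\<^sup>+ t. ennreal (omega c t * polylog u t) * indicator {z<..<1} t \<partial>lborel)"
        using True by (intro nn_integral_cong) (auto simp: h_def indicator_def)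
      then show ?thesis using True nn_integral_kernel[OF assms, of z] by simp
    next
      case False
      then have "h z t = 0" for t by (auto simp: h_def)
      then show ?thesis using False by simp
    qed
  qed
  also have "\<dots> = (\<integral>\<^sup>+ t. \<integral>\<^sup>+ z. h z t \<partial>lborel \<partial>lborel)"
    using lborel_pair.Fubini'[OF hm] by simp
  also have "\<dots> = (\<integral>\<^sup>+ s. ennreal (s * omega c s * polylog u s) * indicator {0<..<1} s \<partial>lborel)"
  proof (intro nn_integral_cong)
    fix t :: real
    show "(\<integral>\<^sup>+ z. h z t \<partial>lborel) = ennreal (t * omega c t * polylog u t) * indicator {0<..<1} t"
    proof (cases "t \<in> {0<..<1}")
      case True
      have "(\<integral>\<^sup>+ z. h z t \<partial>lborel)
          = (\<integral>\<^sup>+ z. ennreal (omega c t * polylog u t) * indicator {0<..<t} z \<partial>lborel)"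
        using True by (intro nn_integral_cong) (auto simp: h_def indicator_def)
      also have "\<dots> = ennreal (omega c t * polylog u t) * ennreal t"
        using True by (simp add: nn_integral_cmult_indicator)
      also have "\<dots> = ennreal (t * omega c t * polylog u t)"
        using True by (subst ennreal_mult''[symmetric]) (simp_all add: mult_ac)
      finally show ?thesis using True by simp
    next
      case False
      then have "h z t = 0" for z by (auto simp: h_def)
      then show ?thesis using False by simp
    qed
  qed
  finally show ?thesis by simp
qed

subsection \<open>Integrals over the simplex\<close>

lemma open_simplex_1: "t \<in> open_simplex (Suc 0) \<longleftrightarrow> t 0 \<in> {0<..<1}"
  by (auto simp: open_simplex_def)

text \<open>In an increasing chain a new last coordinate has to be compared only with its neighbour,
  so the fibre over a point of the smaller simplex is one interval. Positivity of r provides the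
  neighbour.\<close>

lemma open_simplex_Suc:
  assumes "0 < r"
  shows "x(r := y) \<in> open_simplex (Suc r) \<longleftrightarrow> x \<in> open_simplex r \<and> y \<in> {x (r - 1)<..<1}"
proof -
  have le: "x i \<le> x (r - 1)" if "x \<in> open_simplex r" "i < r" for i
    using that by (cases "i = r - 1") (auto simp: open_simplex_def intro!: less_imp_le)
  show ?thesis
  proof
    assume h: "x(r := y) \<in> open_simplex (Suc r)"
    then have p: "0 < (x(r := y)) i \<and> (x(r := y)) i < 1" if "i < Suc r" for i
      using that unfolding open_simplex_def by blast
    have q: "(x(r := y)) i < (x(r := y)) j" if "i < j" "j < Suc r" for i j
      using h that unfolding open_simplex_def by blast
    have "0 < x i \<and> x i < 1" if "i < r" for i using p[of i] that by simp
    moreover have "x i < x j" if "i < j" "j < r" for i j using q[of i j] that by simp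
    moreover have "x (r - 1) < y" using q[of "r - 1" r] assms by (simp split: if_splits)
    moreover have "y < 1" using p[of r] by simp
    ultimately show "x \<in> open_simplex r \<and> y \<in> {x (r - 1)<..<1}"
      by (simp add: open_simplex_def)
  next
    assume h: "x \<in> open_simplex r \<and> y \<in> {x (r - 1)<..<1}"
    have lt: "x i < y" if "i < r" for i using le[of i] h that by fastforce
    have "0 < x (r - 1)" using h assms by (simp add: open_simplex_def)
    then have "0 < y" using h by simp
    with lt show "x(r := y) \<in> open_simplex (Suc r)"
      using h by (simp add: open_simplex_def less_Suc_eq) auto
  qed
qed

text \<open>Stated for a predicate because \<open>open_simplex r\<close> restricts only the
  coordinates below r and is not a subset of the space of extensional functions underlying the
  product measure.\<close>

lemma open_simplex_measurable [measurable]: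
  "Measurable.pred (simplex_measure r) (\<lambda>t. t \<in> open_simplex r)"
proof -
  have [measurable]: "(\<lambda>t. t i) \<in> borel_measurable (simplex_measure r)" if "i \<in> {..<r}" for i
    using measurable_component_singleton[OF that, of "\<lambda>_. lborel"] by simp
  have "(t \<in> open_simplex r) = ((\<forall>i\<in>{..<r}. 0 < t i \<and> t i < 1) \<and>
     (\<forall>i\<in>{..<r}. \<forall>j\<in>{..<r}. i < j \<longrightarrow> t i < t j))" for t
    by (auto simp: open_simplex_def)
  moreover have "Measurable.pred (simplex_measure r) (\<lambda>t. (\<forall>i\<in>{..<r}. 0 < t i \<and> t i < 1) \<and>
     (\<forall>i\<in>{..<r}. \<forall>j\<in>{..<r}. i < j \<longrightarrow> t i < t j))"
    by (intro pred_intros_logic pred_intros_finite finite_lessThan borel_measurable_pred_less) auto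
  ultimately show ?thesis by simp
qed

text \<open>Replacing the power of the logarithm in \<open>ell_integrand\<close> by a general
  \<open>polylog u\<close> gives a family closed under integrating out the last variable.\<close>

definition simplex_integrand :: "letter list \<Rightarrow> letter list \<Rightarrow> (nat \<Rightarrow> real) \<Rightarrow> real" where
  "simplex_integrand a u t =
     t 0 * (\<Prod>i<length a. omega (a ! i) (t i)) * polylog u (t (length a - 1))"

lemma simplex_integrand_measurable:
  assumes "a \<noteq> []"
  shows "simplex_integrand a u \<in> borel_measurable (simplex_measure (length a))"
proof -
  have c: "(\<lambda>t. t i) \<in> borel_measurable (simplex_measure (length a))" if "i < length a" for i
    using measurable_component_singleton[of i "{..<length a}" "\<lambda>_. lborel"] that by simp
  have "(\<lambda>t. t 0 * (\<Prod>i<length a. omega (a ! i) (t i)) * polylog u (t (length a - 1)))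
      \<in> borel_measurable (simplex_measure (length a))"
    using assms
    by (intro borel_measurable_times borel_measurable_prod c
        measurable_compose[OF c omega_measurable] measurable_compose[OF c polylog_measurable]) auto
  then show ?thesis by (simp add: simplex_integrand_def[abs_def])
qed

lemma simplex_integrand_nonneg:
  assumes "t \<in> open_simplex (length a)" "a \<noteq> []"
  shows "0 \<le> simplex_integrand a u t"
proof -
  have "0 < t i \<and> t i < 1" if "i < length a" for i
    using assms(1) that by (auto simp: open_simplex_def)
  then show ?thesis
    unfolding simplex_integrand_def using assms(2)
    by (intro mult_nonneg_nonneg prod_nonneg omega_nonneg polylog_nonneg less_imp_le[of 0 "t 0"] ballI) auto
qed

text \<open>Integrating out the last variable, not the first, needs no shift of the coordinates;
  it moves the last letter of \<open>a\<close> to the front of \<open>u\<close>.\<close>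

lemma simplex_nn_integral:
  assumes "a \<noteq> []" "L0 \<in> set (last a # u)"
  shows "(\<integral>\<^sup>+ t. ennreal (simplex_integrand a u t) * indicator (open_simplex (length a)) t
            \<partial>simplex_measure (length a))
     = (\<integral>\<^sup>+ s. ennreal (s * omega (hd a) s * polylog (tl a @ u) s) * indicator {0<..<1} s \<partial>lborel)"
  using assms
proof (induction a arbitrary: u rule: rev_nonempty_induct)
  case (single c)
  interpret product_sigma_finite "\<lambda>_::nat. lborel :: real measure" ..
  have "(\<integral>\<^sup>+ t. ennreal (simplex_integrand [c] u t) * indicator (open_simplex (length [c])) t
            \<partial>simplex_measure (length [c]))
      = (\<integral>\<^sup>+ t. (\<lambda>s. ennreal (s * omega c s * polylog u s) * indicator {0<..<1} s) (t 0) \<partial>simplex_measure (Suc 0))"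
    by (simp add: simplex_integrand_def indicator_def open_simplex_1)
  also have "\<dots> = (\<integral>\<^sup>+ s. ennreal (s * omega c s * polylog u s) * indicator {0<..<1} s \<partial>lborel)"
  proof -
    have "{..<Suc 0} = {0}" by auto
    then show ?thesis by (simp only:) (rule product_nn_integral_singleton, measurable)
  qed
  finally show ?case by simp
next
  case (snoc c a)
  interpret product_sigma_finite "\<lambda>_::nat. lborel :: real measure" ..
  let ?r = "length a"
  let ?F = "\<lambda>t. ennreal (simplex_integrand (a @ [c]) u t) * indicator (open_simplex (Suc ?r)) t"
  have r: "0 < ?r" using snoc by simp
  have cu: "L0 \<in> set (c # u)" using snoc by simp
  have m: "?F \<in> borel_measurable (Pi\<^sub>M (insert ?r {..<?r}) (\<lambda>_. lborel))"
  proof -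
    have "?F \<in> borel_measurable (simplex_measure (Suc ?r))"
      using simplex_integrand_measurable[of "a @ [c]" u] by simp
    then show ?thesis by (simp add: lessThan_Suc)
  qed
  \<comment> \<open>The first r factors do not involve y and form the constant \<open>A\<close>;
    what remains is the kernel on the fibre interval.\<close>
  have inner: "(\<integral>\<^sup>+ y. ?F (x(?r := y)) \<partial>lborel)
      = ennreal (simplex_integrand a (c # u) x) * indicator (open_simplex ?r) x" for x
  proof (cases "x \<in> open_simplex ?r")
    case True
    define A where "A = x 0 * (\<Prod>i<?r. omega (a ! i) (x i))"
    have xs: "0 < x i \<and> x i < 1" if "i < ?r" for i
      using True that by (auto simp: open_simplex_def)
    have A: "0 \<le> A"
      unfolding A_def using r xs
      by (intro mult_nonneg_nonneg prod_nonneg omega_nonneg less_imp_le[of 0 "x 0"] ballI) auto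
    have z: "0 < x (?r - 1)" "x (?r - 1) < 1" using xs[of "?r - 1"] r by auto
    have "simplex_integrand (a @ [c]) u (x(?r := y)) = A * (omega c y * polylog u y)" for y
    proof -
      have "(\<Prod>i<?r. omega ((a @ [c]) ! i) ((x(?r := y)) i)) = (\<Prod>i<?r. omega (a ! i) (x i))"
        by (intro prod.cong) (auto simp: nth_append)
      then show ?thesis using r by (simp add: simplex_integrand_def A_def mult_ac)
    qed
    then have "(\<integral>\<^sup>+ y. ?F (x(?r := y)) \<partial>lborel)
        = (\<integral>\<^sup>+ y. ennreal A * (ennreal (omega c y * polylog u y) * indicator {x (?r - 1)<..<1} y) \<partial>lborel)"
      using True A
      by (intro nn_integral_cong) (simp add: indicator_def open_simplex_Suc[OF r] ennreal_mult' del: fun_upd_apply)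
    also have "\<dots> = ennreal A * ennreal (polylog (c # u) (x (?r - 1)))"
      by (subst nn_integral_cmult) (simp_all add: nn_integral_kernel[OF cu z, unfolded One_nat_def])
    also have "\<dots> = ennreal (simplex_integrand a (c # u) x)"
      using A by (simp add: ennreal_mult'[symmetric] simplex_integrand_def A_def)
    finally show ?thesis using True by simp
  next
    case False
    then show ?thesis by (simp add: open_simplex_Suc[OF r] del: fun_upd_apply)
  qed
  have "(\<integral>\<^sup>+ t. ?F t \<partial>simplex_measure (Suc ?r)) = (\<integral>\<^sup>+ t. ?F t \<partial>Pi\<^sub>M (insert ?r {..<?r}) (\<lambda>_. lborel))"
    by (simp add: lessThan_Suc)
  also have "\<dots> = (\<integral>\<^sup>+ x. \<integral>\<^sup>+ y. ?F (x(?r := y)) \<partial>lborel \<partial>simplex_measure ?r)"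
    by (rule product_nn_integral_insert[OF _ _ m]) auto
  also have "\<dots> = (\<integral>\<^sup>+ x. ennreal (simplex_integrand a (c # u) x) * indicator (open_simplex ?r) x \<partial>simplex_measure ?r)"
    unfolding inner ..
  \<comment> \<open>The enlarged suffix \<open>c # u\<close> already contains a zero, so the
    induction hypothesis applies whatever the last letter of \<open>a\<close> is.\<close>
  also have "\<dots> = (\<integral>\<^sup>+ s. ennreal (s * omega (hd a) s * polylog (tl a @ c # u) s) * indicator {0<..<1} s \<partial>lborel)"
    using cu by (intro snoc.IH) auto
  finally show ?case using snoc(1) by simp
qed

text \<open>For a nonnegative integrand, finiteness of the extended integral gives convergence and
  value at once. Finiteness comes from \<open>polylog_integrable\<close>, that is, from the
  one-variable bound.\<close>

lemma simplex_integral: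
  assumes "a \<noteq> []" "last a = L0" "L0 \<notin> set u"
  shows "set_integrable (simplex_measure (length a)) (open_simplex (length a)) (simplex_integrand a u)"
    and "(LINT t:open_simplex (length a)|simplex_measure (length a). simplex_integrand a u t)
        = (LBINT z:{0<..<1}. polylog (a @ u) z)"
proof -
  let ?M = "simplex_measure (length a)"
  let ?f = "\<lambda>t. indicator (open_simplex (length a)) t *\<^sub>R simplex_integrand a u t"
  obtain c b where a: "a = c # b" using assms(1) by (cases a) auto
  have L0: "L0 \<in> set (c # b @ u)" using assms last_in_set[of a] a by auto
  have m: "?f \<in> borel_measurable ?M"
    using simplex_integrand_measurable[OF assms(1), of u] by measurable
  have nn: "0 \<le> ?f t" for t
    using simplex_integrand_nonneg[OF _ assms(1), of t u] by (auto simp: indicator_def)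
  have "(\<integral>\<^sup>+ t. ennreal (?f t) \<partial>?M)
      = (\<integral>\<^sup>+ t. ennreal (simplex_integrand a u t) * indicator (open_simplex (length a)) t \<partial>?M)"
    by (intro nn_integral_cong) (auto simp: indicator_def)
  also have "\<dots> = (\<integral>\<^sup>+ z. ennreal (polylog (a @ u) z) * indicator {0<..<1} z \<partial>lborel)"
    using simplex_nn_integral[OF assms(1), of u] nn_integral_polylog[OF L0] assms(2) a by simp
  also have "\<dots> = (\<integral>\<^sup>+ z. ennreal (indicator {0<..<1} z *\<^sub>R polylog (a @ u) z) \<partial>lborel)"
    by (intro nn_integral_cong) (auto simp: indicator_def)
  also have "\<dots> = ennreal (LBINT z:{0<..<1}. polylog (a @ u) z)"
    unfolding set_lebesgue_integral_def
    using polylog_integrable[of "a @ u"] polylog_nonneg[of _ "a @ u"]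
    by (intro nn_integral_eq_integral) (auto simp: set_integrable_def indicator_def)
  finally have eq: "(\<integral>\<^sup>+ t. ennreal (?f t) \<partial>?M) = ennreal (LBINT z:{0<..<1}. polylog (a @ u) z)" .
  show i: "set_integrable ?M (open_simplex (length a)) (simplex_integrand a u)"
    unfolding set_integrable_def using m nn eq by (intro integrableI_nonneg) auto
  have pos: "0 \<le> (LBINT z:{0<..<1}. polylog (a @ u) z)"
    unfolding set_lebesgue_integral_def using polylog_nonneg[of _ "a @ u"]
    by (intro Bochner_Integration.integral_nonneg) (auto simp: indicator_def)
  show "(LINT t:open_simplex (length a)|?M. simplex_integrand a u t) = (LBINT z:{0<..<1}. polylog (a @ u) z)"
    using integral_eq_nn_integral[OF m] nn eq pos by (simp add: set_lebesgue_integral_def)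
qed

subsection \<open>The solution and the Hodge defect\<close>

text \<open>Every letter up to and including the last zero contributes -1, because an integral from
  z to 1 has minus its integrand as derivative; the final ones contribute none.\<close>

fun word_sign :: "letter list \<Rightarrow> real" where
  "word_sign [] = 1"
| "word_sign (c # u) = (if L0 \<in> set (c # u) then - word_sign u else 1)"

definition sol_coeff :: "letter list \<Rightarrow> real \<Rightarrow> real" where
  "sol_coeff v z = word_sign v * polylog v z"

lemma word_sign_ones: "L0 \<notin> set v \<Longrightarrow> word_sign v = 1"
  by (cases v) auto

lemma word_sign_split:
  "a \<noteq> [] \<Longrightarrow> last a = L0 \<Longrightarrow> word_sign (a @ replicate m L1) = (- 1) ^ length a"
proof (induction a)
  case (Cons c a)
  then have "L0 \<in> set (c # a)" using last_in_set by metis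
  then show ?case using Cons word_sign_ones[of "replicate m L1"] by (cases "a = []") auto
qed simp

lemma abs_word_sign: "\<bar>word_sign v\<bar> = 1"
  by (induction v) auto

lemma ell_integrand_eq:
  "ell_integrand a m = (\<lambda>t. fact m * simplex_integrand a (replicate m L1) t)"
  by (rule ext, unfold ell_integrand_def simplex_integrand_def, subst polylog_ones) auto

lemma ell_eq: "ell v = (LBINT z:{0<..<1}. sol_coeff v z)"
proof (cases "L0 \<in> set v")
  case True
  obtain a m where am: "is_splitting v (a, m)" using is_splitting_ex1[OF True] by fastforce
  then have the: "(THE p. is_splitting v p) = (a, m)"
    using is_splitting_ex1[OF True] by (rule the1_equality[rotated])
  from am have a: "a \<noteq> []" "last a = L0" and v: "v = a @ replicate m L1"
    by (auto simp: is_splitting_def)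
  have "ell v = (- 1) ^ length a / fact m * (fact m * (LBINT z:{0<..<1}. polylog v z))"
    using True the simplex_integral(2)[OF a, of "replicate m L1"]
    by (simp add: ell_def ell_integrand_eq v)
  then show ?thesis
    using word_sign_split[OF a, of m] v by (simp add: sol_coeff_def[abs_def])
next
  case False
  then show ?thesis
    using polylog_ones_integral(2)[OF False]
    by (simp add: ell_def sol_coeff_def[abs_def] word_sign_ones)
qed

lemma sol_coeff_integrable: "set_integrable lborel {0<..<1} (sol_coeff v)"
  unfolding sol_coeff_def[abs_def] using polylog_integrable[of v] by simp

text \<open>The two branches of \<open>polylog\<close> differentiate with opposite signs, and
  \<open>word_sign\<close> compensates exactly this, so one recursion governs all words.\<close>

lemma sol_coeff_deriv:
  assumes "0 < z" "z < 1"
  shows "(sol_coeff (c # u) has_real_derivative omega c z * sol_coeff u z) (at z)"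
proof (cases "L0 \<in> set (c # u)")
  case True
  show ?thesis
    using DERIV_cmult[OF polylog_zero_deriv[OF True assms], of "word_sign (c # u)"] True
    by (simp add: sol_coeff_def[abs_def] mult_ac)
next
  case False
  then show ?thesis
    using polylog_ones_deriv[OF False assms(2)] by (simp add: sol_coeff_def[abs_def] word_sign_ones)
qed

text \<open>The normalization multiplies the coefficients by powers of the logarithm; the factor
  sqrt (1 - z) hidden in \<open>majorant\<close> outweighs them.\<close>

lemma sol_coeff_log_tendsto:
  assumes "L0 \<in> set v"
  shows "((\<lambda>z. sol_coeff v z * ln (1 - z) ^ j) \<longlongrightarrow> 0) (at_left 1)"
proof -
  obtain C where C: "0 \<le> C" "\<And>z. 0 < z \<Longrightarrow> z < 1 \<Longrightarrow> polylog v z \<le> C * majorant z"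
    using polylog_bound[OF assms] by blast
  have lim: "((\<lambda>z. C / sqrt z * (\<bar>ln (1 - z)\<bar> ^ j * sqrt (1 - z))) \<longlongrightarrow> C / sqrt 1 * 0) (at_left (1::real))"
    by (intro tendsto_mult ln_power_mult_sqrt_tendsto tendsto_intros) auto
  have "eventually (\<lambda>z. norm (sol_coeff v z * ln (1 - z) ^ j)
      \<le> C / sqrt z * (\<bar>ln (1 - z)\<bar> ^ j * sqrt (1 - z))) (at_left (1::real))"
    using eventually_at_left_real[of 0 1, simplified]
  proof eventually_elim
    case (elim z)
    have "norm (sol_coeff v z * ln (1 - z) ^ j) = polylog v z * \<bar>ln (1 - z)\<bar> ^ j"
      using polylog_nonneg[of z v] elim by (simp add: sol_coeff_def abs_mult abs_word_sign power_abs)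
    also have "\<dots> \<le> C * majorant z * \<bar>ln (1 - z)\<bar> ^ j"
      using C(2)[of z] elim by (intro mult_right_mono) auto
    also have "\<dots> = C / sqrt z * (\<bar>ln (1 - z)\<bar> ^ j * sqrt (1 - z))"
      by (simp add: majorant_def real_sqrt_divide)
    finally show ?case .
  qed
  then show ?thesis by (rule Lim_null_comparison) (use lim in simp)
qed

lemma sol_coeff_conv_tendsto:
  "((\<lambda>z. conv (\<lambda>u. complex_of_real (sol_coeff u z))
      (\<lambda>u. if L0 \<in> set u then 0 else complex_of_real (ln (1 - z)) ^ length u / fact (length u)) v)
    \<longlongrightarrow> (if v = [] then 1 else 0)) (at_left 1)"
proof (cases "L0 \<in> set v")
  case True
  have t: "((\<lambda>z. complex_of_real (sol_coeff (take k v) z) *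
      (if L0 \<in> set (drop k v) then 0 else complex_of_real (ln (1 - z)) ^ length (drop k v) / fact (length (drop k v))))
      \<longlongrightarrow> 0) (at_left 1)" for k
  proof (cases "L0 \<in> set (drop k v)")
    case False
    \<comment> \<open>A cut puts a zero of the word into the suffix, where the second factor
      vanishes identically, or else into the prefix, where the first factor decays.\<close>
    then have "L0 \<in> set (take k v)" using True by (metis UnE append_take_drop_id set_append)
    then have "((\<lambda>z. complex_of_real (sol_coeff (take k v) z * ln (1 - z) ^ length (drop k v) / fact (length (drop k v))))
        \<longlongrightarrow> complex_of_real (0 / fact (length (drop k v)))) (at_left 1)"
      by (intro tendsto_of_real tendsto_divide sol_coeff_log_tendsto tendsto_const) auto
    then show ?thesis using False by (simp del: length_drop)
  qed simp
  have "((\<lambda>z. conv (\<lambda>u. complex_of_real (sol_coeff u z))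
      (\<lambda>u. if L0 \<in> set u then 0 else complex_of_real (ln (1 - z)) ^ length u / fact (length u)) v)
    \<longlongrightarrow> (\<Sum>k\<le>length v. 0)) (at_left 1)"
    unfolding conv_def by (intro tendsto_sum t)
  then show ?thesis using True by auto
next
  case False
  define n where "n = length v"
  have sub: "L0 \<notin> set (take k v)" "L0 \<notin> set (drop k v)" for k
    using False by (auto dest: in_set_takeD in_set_dropD)
  have "conv (\<lambda>u. complex_of_real (sol_coeff u z))
      (\<lambda>u. if L0 \<in> set u then 0 else complex_of_real (ln (1 - z)) ^ length u / fact (length u)) v
    = (if v = [] then 1 else 0)" for z
  proof -
    let ?x = "complex_of_real (ln (1 - z))"
    have "conv (\<lambda>u. complex_of_real (sol_coeff u z))
      (\<lambda>u. if L0 \<in> set u then 0 else ?x ^ length u / fact (length u)) v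
      = (\<Sum>k\<le>n. ((- ?x) ^ k / fact k) * (?x ^ (n - k) / fact (n - k)))"
      unfolding conv_def n_def
      by (intro sum.cong) (auto simp: sub sol_coeff_def word_sign_ones polylog_ones min_def)
    \<comment> \<open>The degree n part of exp (- x) * exp x, so on words of ones the normalized
      product is constant in z and not merely convergent.\<close>
    also have "\<dots> = (- ?x + ?x) ^ n / fact n"
      unfolding binomial_ring sum_divide_distrib
      by (intro sum.cong) (auto simp: binomial_fact field_simps)
    finally show ?thesis by (simp add: n_def power_0_left)
  qed
  then show ?thesis by simp
qed

section \<open>The fundamental solution and the resulting matrix\<close>

definition fundamental_solution :: "letter list \<Rightarrow> real \<Rightarrow> complex mat" where
  "fundamental_solution w z =
     (if 0 < z \<and> z < 1 then word_mat w (\<lambda>v. complex_of_real (sol_coeff v z))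
      else 0\<^sub>m (length w + 1) (length w + 1))"

lemma fundamental_solution_normalized:
  "normalized_solution (length w + 1) (word_op L0 w) (word_op L1 w) (fundamental_solution w)"
  unfolding normalized_solution_def
proof (intro conjI allI impI)
  fix z :: real assume z: "0 < z \<and> z < 1"
  then show "fundamental_solution w z \<in> carrier_mat (length w + 1) (length w + 1)"
    using word_mat_carrier[of w] by (simp add: fundamental_solution_def)
next
  fix z :: real and i j
  assume z: "0 < z \<and> z < 1" and i: "i < length w + 1" and j: "j < length w + 1"
  let ?e = "\<lambda>v. complex_of_real (omega L0 z) * (if v = [L0] then 1 else 0)
      + complex_of_real (omega L1 z) * (if v = [L1] then 1 else 0)"
  let ?R = "((complex_of_real (omega L0 z) \<cdot>\<^sub>m word_op L0 w + complex_of_real (omega L1 z) \<cdot>\<^sub>m word_op L1 w)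
      * fundamental_solution w z) $$ (i, j)"
  have R: "?R = (if i < j then 0 else conv ?e (\<lambda>v. complex_of_real (sol_coeff v z)) (subword w i j))"
  proof -
    have "fundamental_solution w z = word_mat w (\<lambda>v. complex_of_real (sol_coeff v z))"
      using z by (simp add: fundamental_solution_def)
    then show ?thesis
      unfolding connection_mat_eq using i j by (simp only: word_mat_mult) (simp add: word_mat_entry)
  qed
  \<comment> \<open>The connection matrix strips the first letter of the word, which is the
    recursion satisfied by \<open>sol_coeff\<close>.\<close>
  have c: "conv ?e (\<lambda>v. complex_of_real (sol_coeff v z)) (c # u) = complex_of_real (omega c z * sol_coeff u z)" for c u
    by (subst conv_one_letter) (force, cases c, simp_all)
  have "((\<lambda>x. if i < j then 0 else complex_of_real (sol_coeff (subword w i j) x)) has_vector_derivative ?R) (at z)"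
  proof (cases "i < j")
    case False
    show ?thesis
    proof (cases "subword w i j")
      case Nil
      have R0: "?R = 0" unfolding R Nil conv_Nil by simp
      show ?thesis unfolding R0 using False Nil by (simp add: sol_coeff_def)
    next
      case (Cons c u)
      have "((\<lambda>x. complex_of_real (sol_coeff (c # u) x)) has_vector_derivative
          complex_of_real (omega c z * sol_coeff u z)) (at z)"
        using sol_coeff_deriv[of z c u] z
        by (intro has_vector_derivative_of_real) (simp add: has_real_derivative_iff_has_vector_derivative)
      then show ?thesis using False by (simp only: R Cons c if_False)
    qed
  next
    case True
    then have R0: "?R = 0" unfolding R by simp
    show ?thesis unfolding R0 using True by simp
  qed
  then show "((\<lambda>x. fundamental_solution w x $$ (i, j)) has_vector_derivative ?R) (at z)"
    by (rule has_vector_derivative_transform_within_open[of _ _ _ "{0<..<1}"])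
       (use z i j in \<open>auto simp: fundamental_solution_def word_mat_entry\<close>)
next
  fix i j assume i: "i < length w + 1" and j: "j < length w + 1"
  let ?c = "\<lambda>z. conv (\<lambda>u. complex_of_real (sol_coeff u z))
      (\<lambda>u. if L0 \<in> set u then 0 else complex_of_real (ln (1 - z)) ^ length u / fact (length u)) (subword w i j)"
  have lim: "((\<lambda>z. if i < j then 0 else ?c z) \<longlongrightarrow> (if i < j then 0 else if subword w i j = [] then 1 else 0)) (at_left 1)"
    using sol_coeff_conv_tendsto[of "subword w i j"] by (cases "i < j") simp_all
  have one: "1\<^sub>m (length w + 1) $$ (i, j) = (if i < j then 0 else if subword w i j = [] then 1 else (0::complex))"
    unfolding one_mat_eq using i j by (simp add: word_mat_entry)
  have ev: "eventually (\<lambda>z. (if i < j then 0 else ?c z) =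
      (fundamental_solution w z * mat_power (length w + 1) (1 - z) (word_op L1 w)) $$ (i, j)) (at_left (1::real))"
    using eventually_at_left_real[of 0 1, simplified]
  proof eventually_elim
    case (elim z)
    then show ?case
      using i j unfolding mat_power_eq
      by (simp add: fundamental_solution_def word_mat_mult word_mat_entry)
  qed
  show "((\<lambda>z. (fundamental_solution w z * mat_power (length w + 1) (1 - z) (word_op L1 w)) $$ (i, j))
      \<longlongrightarrow> (1\<^sub>m (length w + 1) :: complex mat) $$ (i, j)) (at_left 1)"
    unfolding one by (rule Lim_transform_eventually[OF lim ev])
next
  fix z :: real assume "\<not> (0 < z \<and> z < 1)"
  then show "fundamental_solution w z = 0\<^sub>m (length w + 1) (length w + 1)"
    by (simp only: fundamental_solution_def if_False)
qed

lemma G1_eq: "G1 (length w + 1) (word_op L0 w) (word_op L1 w) = fundamental_solution w"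
  unfolding G1_def
proof (rule the_equality)
  show "normalized_solution (length w + 1) (word_op L0 w) (word_op L1 w) (fundamental_solution w)"
    by (rule fundamental_solution_normalized)
  then show "G = fundamental_solution w"
    if "normalized_solution (length w + 1) (word_op L0 w) (word_op L1 w) G" for G
    using normalized_solution_unique[OF that] by simp
qed

lemma fundamental_solution_entry_integral:
  assumes "b \<le> length w" "a \<le> length w"
  shows "set_integrable lborel {0<..<1} (\<lambda>t. fundamental_solution w t $$ (b, a))"
    and "(LBINT t:{0<..<1}. fundamental_solution w t $$ (b, a))
        = word_mat w (\<lambda>v. complex_of_real (ell v)) $$ (b, a)"
proof -
  have e: "fundamental_solution w t $$ (b, a)
      = complex_of_real (if b < a then 0 else sol_coeff (subword w b a) t)" if "t \<in> {0<..<1}" for t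
    using that assms by (simp add: fundamental_solution_def word_mat_entry)
  have i: "set_integrable lborel {0<..<1} (\<lambda>t. if b < a then 0 else sol_coeff (subword w b a) t)"
    using sol_coeff_integrable by (cases "b < a") (simp_all add: set_integrable_def)
  have "set_integrable lborel {0<..<1} (\<lambda>t. complex_of_real (if b < a then 0 else sol_coeff (subword w b a) t))"
    using integrable_of_real[OF i[unfolded set_integrable_def], where 'a = complex]
    unfolding set_integrable_def by (simp only: scaleR_conv_of_real of_real_mult of_real_eq_id id_apply)
  also have "?this \<longleftrightarrow> set_integrable lborel {0<..<1} (\<lambda>t. fundamental_solution w t $$ (b, a))"
    by (intro set_integrable_cong) (use e in auto)
  finally show "set_integrable lborel {0<..<1} (\<lambda>t. fundamental_solution w t $$ (b, a))" .
  have "(LBINT t:{0<..<1}. fundamental_solution w t $$ (b, a))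
      = (LBINT t:{0<..<1}. complex_of_real (if b < a then 0 else sol_coeff (subword w b a) t))"
    by (intro set_lebesgue_integral_cong) (use e in auto)
  also have "\<dots> = complex_of_real (LBINT t:{0<..<1}. (if b < a then 0 else sol_coeff (subword w b a) t))"
    by (rule set_integral_complex_of_real)
  also have "\<dots> = word_mat w (\<lambda>v. complex_of_real (ell v)) $$ (b, a)"
    using assms by (simp add: word_mat_entry ell_eq)
  finally show "(LBINT t:{0<..<1}. fundamental_solution w t $$ (b, a))
        = word_mat w (\<lambda>v. complex_of_real (ell v)) $$ (b, a)" .
qed

lemma word_hodge_defect_eq: "word_hodge_defect w = word_mat w gcoef"
proof -
  have int: "Matrix.mat (length w + 1) (length w + 1) (\<lambda>(i, j). LBINT t:{0<..<1}. fundamental_solution w t $$ (i, j))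
      = word_mat w (\<lambda>v. complex_of_real (ell v))"
    by (rule eq_matI) (auto simp: fundamental_solution_entry_integral)
  have "1\<^sub>m (length w + 1) + word_op L0 w - word_op L1 w = word_mat w
     (\<lambda>v. (if v = [] then 1 else 0) + (if v = [L0] then 1 else 0) - (if v = [L1] then 1 else 0))"
    by (simp only: one_mat_eq word_op_eq word_mat_add word_mat_diff)
  then have "word_hodge_defect w = word_mat w (conv (\<lambda>v. complex_of_real (kcoef v))
     (\<lambda>u. if L0 \<in> set u then 0 else (- 2 * complex_of_real pi * \<i>) ^ length u / fact (length u + 1)))"
    unfolding word_hodge_defect_def hodge_defect_def G1_eq int U1_def mat_series_word_op
    by (simp only: word_mat_mult kcoef_eq_conv)
  also have "\<dots> = word_mat w gcoef"
    by (rule word_mat_cong) (rule gcoef_eq_conv[symmetric])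
  finally show ?thesis .
qed

lemma gcoef_Nil: "gcoef [] = 1"
  by (simp add: gcoef_eq_conv conv_Nil)

text \<open>The conjuncts on unique existence and integrability ensure that the definite
  descriptions and Bochner integrals in the definitions denote the intended objects and not default
  values.\<close>

theorem proposition7:
  fixes w :: "letter list"
  shows
    "(\<forall>v. L0 \<in> set v \<longrightarrow> (\<exists>!p. is_splitting v p)) \<and>
     (\<forall>a m. a \<noteq> [] \<and> last a = L0 \<longrightarrow>
        set_integrable (simplex_measure (length a)) (open_simplex (length a)) (ell_integrand a m)) \<and>
     gcoef [] = 1 \<and>
     (\<exists>!G. normalized_solution (length w + 1) (word_op L0 w) (word_op L1 w) G) \<and>
     (\<forall>b\<le>length w. \<forall>a\<le>length w.
        set_integrable lborel {0<..<1}
          (\<lambda>t. G1 (length w + 1) (word_op L0 w) (word_op L1 w) t $$ (b, a))) \<and>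
     word_hodge_defect w \<in> carrier_mat (length w + 1) (length w + 1) \<and>
     (\<forall>b\<le>length w. \<forall>a\<le>length w.
        word_hodge_defect w $$ (b, a) =
          (if b < a then 0 else if b = a then 1 else gcoef (subword w b a)))"
proof (intro conjI allI impI)
  show "\<exists>!p. is_splitting v p" if "L0 \<in> set v" for v
    using is_splitting_ex1[OF that] .
  show "set_integrable (simplex_measure (length a)) (open_simplex (length a)) (ell_integrand a m)"
    if "a \<noteq> [] \<and> last a = L0" for a m
    unfolding ell_integrand_eq
    using simplex_integral(1)[of a "replicate m L1"] that by (intro set_integrable_mult_right) auto
  show "gcoef [] = 1" by (rule gcoef_Nil)
  show "\<exists>!G. normalized_solution (length w + 1) (word_op L0 w) (word_op L1 w) G"
    using fundamental_solution_normalized[of w] normalized_solution_unique[of w] by blast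
  show "set_integrable lborel {0<..<1} (\<lambda>t. G1 (length w + 1) (word_op L0 w) (word_op L1 w) t $$ (b, a))"
    if "b \<le> length w" "a \<le> length w" for a b
    unfolding G1_eq by (rule fundamental_solution_entry_integral(1)[OF that])
  show "word_hodge_defect w \<in> carrier_mat (length w + 1) (length w + 1)"
    unfolding word_hodge_defect_eq by (rule word_mat_carrier)
  show "word_hodge_defect w $$ (b, a) = (if b < a then 0 else if b = a then 1 else gcoef (subword w b a))"
    if "b \<le> length w" "a \<le> length w" for a b
    unfolding word_hodge_defect_eq using that by (simp add: word_mat_entry subword_self gcoef_Nil)
qed

end
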